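(* Let $X\subseteq 2^{\mathbb{Z}}$ be a subshift of finite type, let $E$ be the shift equivalence relation on $X$, and assume $E$ has uncountably many classes. Then for every reasonable pointclass $\boldsymbol{\Gamma}$, $(\boldsymbol{\Gamma},E)$-determinacy implies $\boldsymbol{\Gamma}$-determinacy.
   Context: A subshift of finite type is a set of the form $X=\{x\in 2^{\mathbb{Z}}: x \text{ contains no occurrence of any of } w_1,\dots,w_e\}$ for finitely many finite binary words $w_1,\dots,w_e$ (i.e., no restriction of $x$ to an interval of consecutive integers equals some $w_\ell$). The shift equivalence relation $E$ on $X$ is: $x\,E\,y$ iff $y(k)=x(k+m)$ for all $k$, for some $m\in\mathbb{Z}$. A pointclass is a collection of subsets of Polish spaces closed under continuous preimages; it is reasonable if it is closed under unions and intersections with $\boldsymbol{\Delta}^0_6$ sets and under substitutions by $\boldsymbol{\Delta}^0_6$-measurable functions. $(\boldsymbol{\Gamma},E)$-determinacy means: for every continuous surjection $\pi:\omega^\omega\to X$ and every $E$-invariant $A\subseteq X$ in $\boldsymbol{\Gamma}$, the set $\pi^{-1}(A)\subseteq\omega^\omega$ is determined (Gale–Stewart game on natural numbers). $\boldsymbol{\Gamma}$-determinacy means every set in $\boldsymbol{\Gamma}$ is determined. *)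

theory Defs
  imports "HOL-Analysis.Analysis"
begin

definition polish :: "'a topology \<Rightarrow> bool" where
  "polish T \<longleftrightarrow> completely_metrizable_space T \<and> separable_space T"

definition baire :: "(nat \<Rightarrow> nat) topology" where
  "baire = product_topology (\<lambda>_. discrete_topology UNIV) UNIV"

definition cantorZ :: "(int \<Rightarrow> bool) topology" where
  "cantorZ = product_topology (\<lambda>_. discrete_topology UNIV) UNIV"

text \<open>
  The finite levels of the boldface Borel hierarchy, numbered from 1. Taking complements at the
  preceding level only is enough, since the levels are increasing in metrizable spaces.
\<close>

fun Sigma0 :: "'a topology \<Rightarrow> nat \<Rightarrow> 'a set set" where
  "Sigma0 T 0 = {}"
| "Sigma0 T (Suc 0) = {U. openin T U}"
| "Sigma0 T (Suc (Suc n)) =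
    {\<Union>k::nat. topspace T - B k | B. \<forall>k. B k \<in> Sigma0 T (Suc n)}"

definition Pi0 :: "'a topology \<Rightarrow> nat \<Rightarrow> 'a set set" where
  "Pi0 T n = {topspace T - B | B. B \<in> Sigma0 T n}"

definition Delta0 :: "'a topology \<Rightarrow> nat \<Rightarrow> 'a set set" where
  "Delta0 T n = Sigma0 T n \<inter> Pi0 T n"

definition Delta0_measurable :: "nat \<Rightarrow> 'a topology \<Rightarrow> 'b topology \<Rightarrow> ('a \<Rightarrow> 'b) \<Rightarrow> bool" where
  "Delta0_measurable n S T f \<longleftrightarrow>
     f \<in> topspace S \<rightarrow> topspace T \<and>
     (\<forall>U. openin T U \<longrightarrow> {x \<in> topspace S. f x \<in> U} \<in> Delta0 S n)"

text \<open>
  A pointclass assigns to every Polish space a family of its subsets. HOL cannot quantify over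
  all types, so a pointclass is given by its values on the Polish spaces whose points are taken
  from the type \<^typ>\<open>nat \<Rightarrow> nat\<close> (carrying any Polish topology, on any subset of the type). Every
  Polish space has at most continuum many points, hence a homeomorphic copy of this kind
  (\<open>polish_copy\<close> below). Membership of a subset of an arbitrary Polish space is membership of its
  image in such a copy, and does not depend on the copy (\<open>in_pointclass_iff\<close> below), because
  closure under continuous preimages forces invariance under homeomorphisms.
\<close>

type_synonym point_family = "(nat \<Rightarrow> nat) topology \<Rightarrow> (nat \<Rightarrow> nat) set set"

definition pointclass :: "point_family \<Rightarrow> bool" where
  "pointclass \<Gamma> \<longleftrightarrow>
     (\<forall>T. \<forall>A\<in>\<Gamma> T. polish T \<and> A \<subseteq> topspace T) \<and>
     (\<forall>S T f A. polish S \<longrightarrow> polish T \<longrightarrow> continuous_map S T f \<longrightarrow> A \<in> \<Gamma> T \<longrightarrow>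
        {x \<in> topspace S. f x \<in> A} \<in> \<Gamma> S)"

definition reasonable :: "point_family \<Rightarrow> bool" where
  "reasonable \<Gamma> \<longleftrightarrow> pointclass \<Gamma> \<and>
     (\<forall>T A B. polish T \<longrightarrow> A \<in> \<Gamma> T \<longrightarrow> B \<in> Delta0 T 6 \<longrightarrow> A \<union> B \<in> \<Gamma> T \<and> A \<inter> B \<in> \<Gamma> T) \<and>
     (\<forall>S T f A. polish S \<longrightarrow> polish T \<longrightarrow> Delta0_measurable 6 S T f \<longrightarrow> A \<in> \<Gamma> T \<longrightarrow>
        {x \<in> topspace S. f x \<in> A} \<in> \<Gamma> S)"

definition in_pointclass :: "point_family \<Rightarrow> 'a topology \<Rightarrow> 'a set \<Rightarrow> bool" where
  "in_pointclass \<Gamma> T A \<longleftrightarrow>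
     A \<subseteq> topspace T \<and> (\<exists>S h. polish S \<and> homeomorphic_map T S h \<and> h ` A \<in> \<Gamma> S)"

lemma polish_homeomorphic:
  assumes "polish T" "T homeomorphic_space S"
  shows "polish S"
proof -
  obtain h where h: "homeomorphic_map T S h"
    using assms(2) homeomorphic_space by blast
  have "separable_space S"
    using assms(1) h homeomorphic_map_def polish_def separable_space_quotient_map_image by blast
  then show ?thesis
    using assms homeomorphic_completely_metrizable_space unfolding polish_def by blast
qed

lemma polish_inj:
  assumes "polish (T :: 'a topology)"
  obtains f :: "'a \<Rightarrow> nat \<Rightarrow> nat" where "inj_on f (topspace T)"
proof -
  obtain M d where M: "Metric_space M d" and T: "T = Metric_space.mtopology M d"
    using assms unfolding polish_def completely_metrizable_space_def by blast
  interpret Metric_space M d by (rule M)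
  obtain D where D: "countable D" "D \<subseteq> M" "mtopology closure_of D = M"
    using assms unfolding polish_def separable_space_def T by auto
  define f where "f = (\<lambda>x n. let (i, k) = prod_decode n in
      if d x (from_nat_into D i) < inverse (of_nat (Suc k)) then 1 else (0::nat))"
  have "inj_on f M"
  proof (rule inj_onI, rule ccontr)
    fix x y assume x: "x \<in> M" and y: "y \<in> M" and eq: "f x = f y" and ne: "x \<noteq> y"
    have "d x y > 0" using x y ne by simp
    then obtain k where k: "inverse (of_nat (Suc k)) < d x y / 2"
      using reals_Archimedean[of "d x y / 2"] by auto
    have "x \<in> mtopology closure_of D" using D x by simp
    then obtain z where z: "z \<in> D" "z \<in> mball x (inverse (of_nat (Suc k)))"
    proof -
      have "(0::real) < inverse (of_nat (Suc k))" by simp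
      with \<open>x \<in> mtopology closure_of D\<close> show thesis
        unfolding metric_closure_of using that by blast
    qed
    obtain i where i: "from_nat_into D i = z"
      using D(1) z(1) from_nat_into_surj by metis
    have "d x z < inverse (of_nat (Suc k))" using z by simp
    moreover have "f x (prod_encode (i, k)) = f y (prod_encode (i, k))" using eq by simp
    ultimately have "d y z < inverse (of_nat (Suc k))"
      unfolding f_def by (simp add: i split: if_splits)
    moreover have "d x y \<le> d x z + d y z"
      using x y z D by (metis commute subsetD triangle)
    ultimately show False
      using k \<open>d x z < _\<close> by linarith
  qed
  then show thesis using that T by auto
qed

lemma polish_copy:
  assumes "polish T"
  shows "\<exists>S :: (nat \<Rightarrow> nat) topology. polish S \<and> T homeomorphic_space S"
proof -
  obtain f :: "'a \<Rightarrow> nat \<Rightarrow> nat" where f: "inj_on f (topspace T)"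
    using polish_inj assms by blast
  define g where "g = inv_into (topspace T) f"
  define S where "S = pullback_topology (f ` topspace T) g T"
  have gf: "g (f x) = x" if "x \<in> topspace T" for x
    using f that by (simp add: g_def)
  have top: "topspace S = f ` topspace T"
    unfolding S_def topspace_pullback_topology using gf by auto
  have "continuous_map S T g"
    unfolding continuous_map_def
  proof (intro conjI allI impI)
    show "g \<in> topspace S \<rightarrow> topspace T" using top gf by auto
    fix U assume "openin T U"
    moreover have "{x \<in> topspace S. g x \<in> U} = g -` U \<inter> f ` topspace T"
      using top by auto
    ultimately show "openin S {x \<in> topspace S. g x \<in> U}"
      unfolding S_def openin_pullback_topology by blast
  qed
  moreover have "continuous_map T S f"
    unfolding continuous_map_def
  proof (intro conjI allI impI)
    show "f \<in> topspace T \<rightarrow> topspace S" using top by auto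
    fix V assume "openin S V"
    then obtain U where U: "openin T U" "V = g -` U \<inter> f ` topspace T"
      unfolding S_def openin_pullback_topology by blast
    have "f x \<in> V \<longleftrightarrow> x \<in> U" if "x \<in> topspace T" for x
      using that gf[OF that] unfolding U(2) by simp
    then have "{x \<in> topspace T. f x \<in> V} = U"
      using openin_subset[OF U(1)] by blast
    then show "openin T {x \<in> topspace T. f x \<in> V}" using U by simp
  qed
  ultimately have "homeomorphic_maps T S f g"
    unfolding homeomorphic_maps_def using gf top by auto
  then have "T homeomorphic_space S"
    unfolding homeomorphic_space_def by blast
  then show ?thesis using assms polish_homeomorphic by blast
qed

lemma in_pointclass_iff:
  assumes "pointclass \<Gamma>" "polish S" "homeomorphic_map T S h"
  shows "in_pointclass \<Gamma> T A \<longleftrightarrow> A \<subseteq> topspace T \<and> h ` A \<in> \<Gamma> S"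
proof
  assume "in_pointclass \<Gamma> T A"
  then obtain S' h' where A: "A \<subseteq> topspace T" and S': "polish S'" "homeomorphic_map T S' h'"
    "h' ` A \<in> \<Gamma> S'"
    unfolding in_pointclass_def by blast
  obtain g where g: "homeomorphic_maps T S h g"
    using assms(3) homeomorphic_map_maps by blast
  have "continuous_map S S' (h' \<circ> g)"
    using g S'(2) by (meson continuous_map_compose homeomorphic_imp_continuous_map homeomorphic_maps_def)
  then have "{x \<in> topspace S. (h' \<circ> g) x \<in> h' ` A} \<in> \<Gamma> S"
    using assms(1,2) S' unfolding pointclass_def by blast
  moreover have "{x \<in> topspace S. (h' \<circ> g) x \<in> h' ` A} = h ` A"
  proof -
    have inj: "inj_on h' (topspace T)"
      using S'(2) homeomorphic_imp_injective_map by blast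
    have gT: "g x \<in> topspace T" if "x \<in> topspace S" for x
      using g that unfolding homeomorphic_maps_def continuous_map_def by blast
    have hT: "h x \<in> topspace S" if "x \<in> topspace T" for x
      using g that unfolding homeomorphic_maps_def continuous_map_def by blast
    have hg: "h (g y) = y" if "y \<in> topspace S" for y
      using g that unfolding homeomorphic_maps_def by blast
    have gh: "g (h x) = x" if "x \<in> topspace T" for x
      using g that unfolding homeomorphic_maps_def by blast
    have "h' (g x) \<in> h' ` A \<longleftrightarrow> g x \<in> A" if "x \<in> topspace S" for x
      using inj gT[OF that] A by (simp add: inj_on_image_mem_iff)
    then show ?thesis
      using A hT hg gh by (auto simp: image_iff subset_iff) (metis hg)
  qed
  ultimately show "A \<subseteq> topspace T \<and> h ` A \<in> \<Gamma> S" using A by simp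
next
  assume "A \<subseteq> topspace T \<and> h ` A \<in> \<Gamma> S"
  then show "in_pointclass \<Gamma> T A"
    unfolding in_pointclass_def using assms by blast
qed

text \<open>
  Player I moves at even, player II at odd stages. A strategy is a function of the whole
  position, of which only the values at positions of its owner matter.
\<close>

definition follows_I :: "(nat list \<Rightarrow> nat) \<Rightarrow> (nat \<Rightarrow> nat) \<Rightarrow> bool" where
  "follows_I \<sigma> x \<longleftrightarrow> (\<forall>n. even n \<longrightarrow> x n = \<sigma> (map x [0..<n]))"

definition follows_II :: "(nat list \<Rightarrow> nat) \<Rightarrow> (nat \<Rightarrow> nat) \<Rightarrow> bool" where
  "follows_II \<tau> x \<longleftrightarrow> (\<forall>n. odd n \<longrightarrow> x n = \<tau> (map x [0..<n]))"

definition determined :: "(nat \<Rightarrow> nat) set \<Rightarrow> bool" where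
  "determined A \<longleftrightarrow>
     (\<exists>\<sigma>. \<forall>x. follows_I \<sigma> x \<longrightarrow> x \<in> A) \<or> (\<exists>\<tau>. \<forall>x. follows_II \<tau> x \<longrightarrow> x \<notin> A)"

definition pointclass_determinacy :: "point_family \<Rightarrow> bool" where
  "pointclass_determinacy \<Gamma> \<longleftrightarrow> (\<forall>A\<in>\<Gamma> baire. determined A)"

definition invariant_under :: "('a \<times> 'a) set \<Rightarrow> 'a set \<Rightarrow> bool" where
  "invariant_under E A \<longleftrightarrow> (\<forall>(x, y)\<in>E. x \<in> A \<longleftrightarrow> y \<in> A)"

definition equiv_determinacy :: "point_family \<Rightarrow> 'a topology \<Rightarrow> ('a \<times> 'a) set \<Rightarrow> bool" where
  "equiv_determinacy \<Gamma> T E \<longleftrightarrow>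
     (\<forall>\<pi> A. continuous_map baire T \<pi> \<longrightarrow> range \<pi> = topspace T \<longrightarrow>
        A \<subseteq> topspace T \<longrightarrow> invariant_under E A \<longrightarrow> in_pointclass \<Gamma> T A \<longrightarrow>
        determined (\<pi> -` A))"

definition occurs_in :: "bool list \<Rightarrow> (int \<Rightarrow> bool) \<Rightarrow> bool" where
  "occurs_in w x \<longleftrightarrow> (\<exists>i. \<forall>j<length w. x (i + int j) = w ! j)"

definition subshift_of_finite_type :: "(int \<Rightarrow> bool) set \<Rightarrow> bool" where
  "subshift_of_finite_type X \<longleftrightarrow> (\<exists>W. finite W \<and> X = {x. \<forall>w\<in>W. \<not> occurs_in w x})"

definition shift_equiv :: "(int \<Rightarrow> bool) set \<Rightarrow> ((int \<Rightarrow> bool) \<times> (int \<Rightarrow> bool)) set" where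
  "shift_equiv X = {(x, y). x \<in> X \<and> y \<in> X \<and> (\<exists>m. \<forall>k. y k = x (k + m))}"

end

theory Submission
  imports Defs
begin

text \<open>
  A point of \<open>X\<close> is a bi-infinite path in a finite graph of windows. If no vertex has two distinct
  return paths of equal length, every path is eventually periodic in both directions and \<open>X\<close> is
  countable. Otherwise two distinct blocks \<open>u\<close>, \<open>v\<close> of the same length \<open>q\<close> can be concatenated
  freely inside \<open>X\<close>. A real \<open>y\<close> is coded continuously by a point \<open>\<dots>uuuv\<dots>\<close> whose further blocks
  spell out the graph of \<open>y\<close>. The first failure of \<open>q\<close>-periodicity marks a position that moves
  along with shifts, so that decoding relative to it is a shift-invariant map; it is of low Borel
  class. Hence every \<open>A\<close> in \<open>\<Gamma>\<close> is the preimage, under the coding map, of an invariant set in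
  \<open>\<Gamma>\<close>. The coding map is not onto, which is repaired by two preliminary moves: whenever player I
  declines to play the coding game, player II can win immediately, and if both decline, the rest of
  the play enumerates \<open>X\<close>.
\<close>

section \<open>Products of discrete spaces\<close>

lemma openin_product_discrete_iff:
  "openin (product_topology (\<lambda>_::'i. discrete_topology (UNIV::'v set)) UNIV) U \<longleftrightarrow>
     (\<forall>x\<in>U. \<exists>F. finite F \<and> (\<forall>y. (\<forall>i\<in>F. y i = x i) \<longrightarrow> y \<in> U))" (is "?lhs \<longleftrightarrow> ?rhs")
proof
  assume L: ?lhs
  show ?rhs
  proof
    fix x assume "x \<in> U"
    then obtain V where V: "finite {i. V i \<noteq> (UNIV::'v set)}" "x \<in> Pi\<^sub>E UNIV V" "Pi\<^sub>E UNIV V \<subseteq> U"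
      using L unfolding openin_product_topology_alt by auto
    have "y \<in> U" if "\<forall>i\<in>{i. V i \<noteq> UNIV}. y i = x i" for y
    proof -
      have "y i \<in> V i" for i
        using that V(2) by (cases "V i = UNIV") (auto simp: PiE_def Pi_def)
      then show ?thesis using V(3) by (auto simp: PiE_def Pi_def)
    qed
    then show "\<exists>F. finite F \<and> (\<forall>y. (\<forall>i\<in>F. y i = x i) \<longrightarrow> y \<in> U)"
      using V(1) by blast
  qed
next
  assume R: ?rhs
  show ?lhs
    unfolding openin_product_topology_alt
  proof
    fix x assume "x \<in> U"
    then obtain F where F: "finite F" "\<And>y. (\<forall>i\<in>F. y i = x i) \<Longrightarrow> y \<in> U"
      using R by blast
    define V where "V = (\<lambda>i. if i \<in> F then {x i} else UNIV)"
    have "finite {i. V i \<noteq> UNIV}"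
      by (rule finite_subset[OF _ F(1)]) (auto simp: V_def)
    moreover have "x \<in> Pi\<^sub>E UNIV V" by (auto simp: V_def)
    moreover have "Pi\<^sub>E UNIV V \<subseteq> U"
    proof
      fix y assume "y \<in> Pi\<^sub>E UNIV V"
      then have "y i \<in> V i" for i by auto
      then have "\<forall>i\<in>F. y i = x i" by (metis V_def singletonD)
      then show "y \<in> U" by (rule F(2))
    qed
    ultimately show "\<exists>V. finite {i \<in> UNIV. V i \<noteq> topspace (discrete_topology UNIV)} \<and>
        (\<forall>i\<in>UNIV. openin (discrete_topology UNIV) (V i)) \<and> x \<in> Pi\<^sub>E UNIV V \<and> Pi\<^sub>E UNIV V \<subseteq> U"
      by auto
  qed
qed

lemma second_countable_product_discrete:
  "second_countable (product_topology (\<lambda>_::'i::countable. discrete_topology (UNIV::'v::countable set)) UNIV)"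
    (is "second_countable ?T")
proof -
  \<comment> \<open>Finite lists of prescribed coordinates form a countable set, so the basis of
    cylinders is countable; contradictory lists merely give the empty set.\<close>
  define cyl :: "('i \<times> 'v) list \<Rightarrow> ('i \<Rightarrow> 'v) set"
    where "cyl l = {f. \<forall>(i, v)\<in>set l. f i = v}" for l
  have "openin ?T (cyl l)" for l
    unfolding openin_product_discrete_iff
  proof
    fix x assume "x \<in> cyl l"
    then have "\<forall>y. (\<forall>i\<in>fst ` set l. y i = x i) \<longrightarrow> y \<in> cyl l"
      unfolding cyl_def by fastforce
    then show "\<exists>F. finite F \<and> (\<forall>y. (\<forall>i\<in>F. y i = x i) \<longrightarrow> y \<in> cyl l)"
      by (meson finite_imageI finite_set)
  qed
  moreover have "\<exists>V\<in>range cyl. x \<in> V \<and> V \<subseteq> U" if U: "openin ?T U" "x \<in> U" for U x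
  proof -
    obtain F where F: "finite F" "\<And>y. (\<forall>i\<in>F. y i = x i) \<Longrightarrow> y \<in> U"
      using U unfolding openin_product_discrete_iff by blast
    obtain l where "set l = F" using F(1) finite_list by blast
    then have "x \<in> cyl (map (\<lambda>i. (i, x i)) l) \<and> cyl (map (\<lambda>i. (i, x i)) l) \<subseteq> U"
      using F(2) by (auto simp: cyl_def)
    then show ?thesis by blast
  qed
  moreover have "countable (range cyl)" by simp
  ultimately show ?thesis
    unfolding second_countable_def by (intro exI[of _ "range cyl"]) blast
qed

lemma completely_metrizable_product_discrete:
  "completely_metrizable_space
    (product_topology (\<lambda>_::'i::countable. discrete_topology (UNIV::'v set)) UNIV)"
  by (simp add: completely_metrizable_space_product_topology
      completely_metrizable_space_discrete_topology)

lemma polish_baire: "polish baire"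
  unfolding baire_def polish_def
  by (intro conjI completely_metrizable_product_discrete second_countable_imp_separable_space
      second_countable_product_discrete)

lemma polish_closed_cantorZ:
  assumes "closedin cantorZ X"
  shows "polish (subtopology cantorZ X)"
  using assms completely_metrizable_product_discrete second_countable_product_discrete
  unfolding polish_def cantorZ_def
  by (intro conjI completely_metrizable_space_closedin second_countable_imp_separable_space
      second_countable_subtopology)

lemma topspace_baire [simp]: "topspace baire = UNIV"
  by (simp add: baire_def)

lemma topspace_cantorZ [simp]: "topspace cantorZ = UNIV"
  by (simp add: cantorZ_def)

lemma openin_baire_iff:
  "openin baire U \<longleftrightarrow> (\<forall>x\<in>U. \<exists>n. \<forall>y. (\<forall>i<n. y i = x i) \<longrightarrow> y \<in> U)"
proof -
  have "(\<exists>F. finite F \<and> (\<forall>y. (\<forall>i\<in>F. y i = x i) \<longrightarrow> y \<in> U)) \<longleftrightarrow>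
      (\<exists>n. \<forall>y. (\<forall>i<n. y i = x i) \<longrightarrow> y \<in> U)" for x :: "nat \<Rightarrow> nat"
  proof
    assume "\<exists>F. finite F \<and> (\<forall>y. (\<forall>i\<in>F. y i = x i) \<longrightarrow> y \<in> U)"
    then obtain F where F: "finite F" "\<And>y. (\<forall>i\<in>F. y i = x i) \<Longrightarrow> y \<in> U" by blast
    obtain n where "\<forall>i\<in>F. i < n" using F(1) unfolding finite_nat_set_iff_bounded ..
    then have "\<forall>y. (\<forall>i<n. y i = x i) \<longrightarrow> y \<in> U" using F(2) by simp
    then show "\<exists>n. \<forall>y. (\<forall>i<n. y i = x i) \<longrightarrow> y \<in> U" ..
  next
    assume "\<exists>n. \<forall>y. (\<forall>i<n. y i = x i) \<longrightarrow> y \<in> U"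
    then show "\<exists>F. finite F \<and> (\<forall>y. (\<forall>i\<in>F. y i = x i) \<longrightarrow> y \<in> U)"
      by (metis finite_lessThan lessThan_iff)
  qed
  then show ?thesis unfolding baire_def openin_product_discrete_iff by (simp only:)
qed

lemma continuous_map_baire_cantorZ:
  assumes "\<And>x i. \<exists>n. \<forall>y. (\<forall>k<n. y k = x k) \<longrightarrow> f y i = f x i"
  shows "continuous_map baire cantorZ f"
  unfolding cantorZ_def continuous_map_componentwise_UNIV
proof
  fix i
  have "openin baire {x. f x i \<in> V}" for V
    unfolding openin_baire_iff
  proof
    fix x assume x: "x \<in> {x. f x i \<in> V}"
    obtain n where n: "\<forall>y. (\<forall>k<n. y k = x k) \<longrightarrow> f y i = f x i" using assms by blast
    have "\<forall>y. (\<forall>k<n. y k = x k) \<longrightarrow> y \<in> {x. f x i \<in> V}"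
    proof (intro allI impI)
      fix y assume "\<forall>k<n. y k = x k"
      with n have "f y i = f x i" by blast
      then show "y \<in> {x. f x i \<in> V}" using x by (simp only: mem_Collect_eq)
    qed
    then show "\<exists>n. \<forall>y. (\<forall>k<n. y k = x k) \<longrightarrow> y \<in> {x. f x i \<in> V}" ..
  qed
  then show "continuous_map baire (discrete_topology UNIV) (\<lambda>x. f x i)"
    by (simp add: continuous_map_def)
qed

section \<open>Finite Borel levels\<close>

lemma Sigma0_Suc: "n \<ge> 1 \<Longrightarrow> Sigma0 T (Suc n) = {\<Union>k::nat. topspace T - B k | B. \<forall>k. B k \<in> Sigma0 T n}"
  by (cases n) auto

lemma Sigma0_preimage:
  assumes "continuous_map S T f" "B \<in> Sigma0 T n"
  shows "{x \<in> topspace S. f x \<in> B} \<in> Sigma0 S n"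
  using assms
proof (induction T n arbitrary: B rule: Sigma0.induct)
  case (2 T)
  then show ?case by (auto intro: openin_continuous_map_preimage)
next
  case (3 T n)
  then obtain C where C: "B = (\<Union>k::nat. topspace T - C k)" "\<And>k. C k \<in> Sigma0 T (Suc n)"
    by auto
  have "{x \<in> topspace S. f x \<in> B} = (\<Union>k::nat. topspace S - {x \<in> topspace S. f x \<in> C k})"
    using 3(2) C(1) by (auto simp: continuous_map_def Pi_def)
  moreover have "{x \<in> topspace S. f x \<in> C k} \<in> Sigma0 S (Suc n)" for k
    using 3 C(2) by blast
  ultimately show ?case by auto
qed simp

lemma Compl_in_Sigma0_Suc:
  assumes "n \<ge> 1" "B \<in> Sigma0 T n"
  shows "topspace T - B \<in> Sigma0 T (Suc n)"
  unfolding Sigma0_Suc[OF assms(1)] mem_Collect_eq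
  by (rule exI[of _ "\<lambda>_. B"]) (use assms(2) in simp)

lemma Sigma0_UN_nat:
  assumes "n \<ge> 1" "\<And>k::nat. B k \<in> Sigma0 T n"
  shows "(\<Union>k. B k) \<in> Sigma0 T n"
proof (cases "n = 1")
  case True
  then show ?thesis using assms(2) by auto
next
  case False
  then obtain m where m: "n = Suc m" "m \<ge> 1" using assms(1) by (cases n) auto
  have "\<forall>k. \<exists>C. B k = (\<Union>j::nat. topspace T - C j) \<and> (\<forall>j. C j \<in> Sigma0 T m)"
    using assms(2) unfolding m Sigma0_Suc[OF m(2)] by blast
  then obtain C where C: "\<And>k. B k = (\<Union>j::nat. topspace T - C k j)" "\<And>k j. C k j \<in> Sigma0 T m"
    by metis
  define D where "D i = (case prod_decode i of (k, j) \<Rightarrow> C k j)" for i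
  have D: "D (prod_encode (k, j)) = C k j" for k j by (simp add: D_def)
  have "(\<Union>k. B k) = (\<Union>i. topspace T - D i)"
  proof (intro equalityI subsetI)
    fix x assume "x \<in> (\<Union>k. B k)"
    then obtain k j where "x \<in> topspace T - C k j" using C(1) by blast
    then show "x \<in> (\<Union>i. topspace T - D i)" using D by (metis UN_I UNIV_I)
  next
    fix x assume "x \<in> (\<Union>i. topspace T - D i)"
    then obtain i where "x \<in> topspace T - D i" by blast
    then show "x \<in> (\<Union>k. B k)" unfolding C(1) D_def by (auto split: prod.splits)
  qed
  moreover have "\<forall>i. D i \<in> Sigma0 T m"
    using C(2) by (simp add: D_def split: prod.splits)
  ultimately show ?thesis unfolding m Sigma0_Suc[OF m(2)] by blast
qed

lemma empty_in_Sigma0: "n \<ge> 1 \<Longrightarrow> {} \<in> Sigma0 T n"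
  and topspace_in_Sigma0: "n \<ge> 1 \<Longrightarrow> topspace T \<in> Sigma0 T n"
proof -
  have "{} \<in> Sigma0 T n \<and> topspace T \<in> Sigma0 T n" if "n \<ge> 1" for n
    using that
  proof (induction n rule: dec_induct)
    case (step n)
    then show ?case
      using Compl_in_Sigma0_Suc[of n "{}" T] Compl_in_Sigma0_Suc[of n "topspace T" T] by simp
  qed simp
  then show "n \<ge> 1 \<Longrightarrow> {} \<in> Sigma0 T n" "n \<ge> 1 \<Longrightarrow> topspace T \<in> Sigma0 T n" by auto
qed

lemma Sigma0_UN:
  assumes "n \<ge> 1" "countable I" "\<And>i. i \<in> I \<Longrightarrow> B i \<in> Sigma0 T n"
  shows "(\<Union>i\<in>I. B i) \<in> Sigma0 T n"
proof (cases "I = {}")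
  case True
  then show ?thesis by (simp add: empty_in_Sigma0[OF assms(1)])
next
  case False
  then have "(\<Union>i\<in>I. B i) = (\<Union>k. B (from_nat_into I k))"
    using range_from_nat_into[OF False assms(2)] by (metis image_image)
  also have "\<dots> \<in> Sigma0 T n"
    using assms(3) from_nat_into[OF False] by (intro Sigma0_UN_nat[OF assms(1)]) simp
  finally show ?thesis .
qed

lemma Sigma0_Un:
  assumes "n \<ge> 1" "B \<in> Sigma0 T n" "C \<in> Sigma0 T n"
  shows "B \<union> C \<in> Sigma0 T n"
proof -
  have "(\<Union>D\<in>{B, C}. D) \<in> Sigma0 T n"
    by (rule Sigma0_UN) (use assms in auto)
  then show ?thesis by simp
qed

text \<open>Above level 1, distributing the two unions leaves complements of the sets
  \<open>D j \<union> E k\<close>, so closure of the preceding level under finite unions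
  suffices.\<close>

lemma Sigma0_Int:
  assumes "n \<ge> 1" "B \<in> Sigma0 T n" "C \<in> Sigma0 T n"
  shows "B \<inter> C \<in> Sigma0 T n"
proof (cases "n = 1")
  case True
  then show ?thesis using assms by auto
next
  case False
  then obtain m where m: "n = Suc m" "m \<ge> 1" using assms(1) by (cases n) auto
  obtain D where D: "B = (\<Union>k::nat. topspace T - D k)" "\<And>k. D k \<in> Sigma0 T m"
    using assms(2) unfolding m Sigma0_Suc[OF m(2)] by blast
  obtain E where E: "C = (\<Union>k::nat. topspace T - E k)" "\<And>k. E k \<in> Sigma0 T m"
    using assms(3) unfolding m Sigma0_Suc[OF m(2)] by blast
  have "B \<inter> C = (\<Union>(j, k)\<in>UNIV. topspace T - (D j \<union> E k))"
    unfolding D(1) E(1) by auto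
  also have "\<dots> \<in> Sigma0 T n"
    using D(2) E(2) m by (intro Sigma0_UN) (auto intro!: Compl_in_Sigma0_Suc Sigma0_Un)
  finally show ?thesis .
qed

text \<open>The factor \<open>topspace T\<close> accounts for an empty index set, whose plain
  intersection is \<open>UNIV\<close>.\<close>

lemma Sigma0_INT:
  assumes "n \<ge> 1" "finite I" "\<And>i. i \<in> I \<Longrightarrow> B i \<in> Sigma0 T n"
  shows "topspace T \<inter> (\<Inter>i\<in>I. B i) \<in> Sigma0 T n"
  using assms(2,3)
proof (induction I rule: finite_induct)
  case empty
  then show ?case by (simp add: topspace_in_Sigma0[OF assms(1)])
next
  case (insert i I)
  then have "B i \<inter> (topspace T \<inter> (\<Inter>i\<in>I. B i)) \<in> Sigma0 T n"
    by (blast intro: Sigma0_Int[OF assms(1)])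
  moreover have "B i \<inter> (topspace T \<inter> (\<Inter>i\<in>I. B i)) = topspace T \<inter> (\<Inter>i\<in>insert i I. B i)" by auto
  ultimately show ?case by simp
qed

text \<open>Metrizability enters at level 1, where open sets must be countable unions of closed
  sets. From there the inclusion passes through complements and countable unions.\<close>

lemma Sigma0_mono_Suc:
  assumes "metrizable_space T" "n \<ge> 1"
  shows "Sigma0 T n \<subseteq> Sigma0 T (Suc n)"
  using assms(2)
proof (induction n rule: dec_induct)
  case base
  show ?case
  proof
    fix U assume "U \<in> Sigma0 T 1"
    then have "fsigma_in T U" using open_imp_fsigma_in[OF assms(1)] by simp
    then obtain \<C> where \<C>: "countable \<C>" "\<And>C. C \<in> \<C> \<Longrightarrow> closedin T C" "\<Union>\<C> = U"
      unfolding fsigma_in_def union_of_def by auto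
    have "C \<in> Sigma0 T (Suc 1)" if "C \<in> \<C>" for C
    proof -
      have "topspace T - C \<in> Sigma0 T 1" using \<C>(2)[OF that] by (simp add: closedin_def)
      then have "topspace T - (topspace T - C) \<in> Sigma0 T (Suc 1)"
        by (rule Compl_in_Sigma0_Suc[rotated]) simp
      then show ?thesis
        using closedin_subset[OF \<C>(2)[OF that]] by (simp add: double_diff)
    qed
    then show "U \<in> Sigma0 T (Suc 1)"
      using Sigma0_UN[of "Suc 1" \<C> id T] \<C> by simp
  qed
next
  case (step n)
  show ?case
  proof
    fix B assume "B \<in> Sigma0 T (Suc n)"
    then obtain C where C: "B = (\<Union>k::nat. topspace T - C k)" "\<And>k. C k \<in> Sigma0 T n"
      unfolding Sigma0_Suc[OF step.hyps(1)] by blast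
    have "topspace T - C k \<in> Sigma0 T (Suc (Suc n))" for k
      using step.IH C(2) by (intro Compl_in_Sigma0_Suc) auto
    then show "B \<in> Sigma0 T (Suc (Suc n))"
      unfolding C(1) by (rule Sigma0_UN_nat[rotated]) simp
  qed
qed

lemma Sigma0_mono:
  assumes "metrizable_space T" "1 \<le> m" "m \<le> n"
  shows "Sigma0 T m \<subseteq> Sigma0 T n"
  using assms(3)
proof (induction n rule: dec_induct)
  case (step n)
  then show ?case using Sigma0_mono_Suc[OF assms(1), of n] assms(2) by simp
qed simp

lemma closedin_in_Sigma0:
  assumes "closedin T C" "metrizable_space T" "n \<ge> 2"
  shows "C \<in> Sigma0 T n"
proof -
  have "topspace T - (topspace T - C) \<in> Sigma0 T (Suc 1)"
    using assms(1) by (intro Compl_in_Sigma0_Suc) (auto simp: closedin_def)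
  then have "C \<in> Sigma0 T 2"
    using closedin_subset[OF assms(1)] by (simp add: double_diff numeral_2_eq_2)
  then show ?thesis using Sigma0_mono[OF assms(2), of 2 n] assms(3) by auto
qed

text \<open>An open set of the Baire space is a countable union of cylinders, each given by a finite
  list of values, so its preimage is in \<open>Sigma0 T n\<close>. The level rises by one because
  \<open>Sigma0 T n\<close> lies in both \<open>Sigma0\<close> and \<open>Pi0\<close> of the next
  level.\<close>

lemma Delta0_measurable_baireI:
  assumes T: "metrizable_space T" and n: "n \<ge> 1"
    and f: "\<And>k m. {x \<in> topspace T. f x k = m} \<in> Sigma0 T n"
  shows "Delta0_measurable (Suc n) T baire f"
  unfolding Delta0_measurable_def
proof (intro conjI allI impI)
  show "f \<in> topspace T \<rightarrow> topspace baire" by simp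
  fix U assume U: "openin baire U"
  define L where "L = {l. \<forall>y. (\<forall>i<length l. y i = l ! i) \<longrightarrow> y \<in> U}"
  have "{x \<in> topspace T. f x \<in> U} =
      (\<Union>l\<in>L. topspace T \<inter> (\<Inter>i\<in>{..<length l}. {x \<in> topspace T. f x i = l ! i}))"
  proof (intro equalityI subsetI)
    fix x assume "x \<in> {x \<in> topspace T. f x \<in> U}"
    then have x: "x \<in> topspace T" "f x \<in> U" by auto
    then obtain n where n: "\<forall>y. (\<forall>i<n. y i = f x i) \<longrightarrow> y \<in> U"
      using U unfolding openin_baire_iff by blast
    then have "map (f x) [0..<n] \<in> L" by (simp add: L_def)
    moreover have "x \<in> (\<Inter>i\<in>{..<length (map (f x) [0..<n])}.
        {z \<in> topspace T. f z i = map (f x) [0..<n] ! i})" using x by simp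
    ultimately show "x \<in> (\<Union>l\<in>L. topspace T \<inter> (\<Inter>i\<in>{..<length l}. {x \<in> topspace T. f x i = l ! i}))"
      using x(1) by blast
  next
    fix x assume "x \<in> (\<Union>l\<in>L. topspace T \<inter> (\<Inter>i\<in>{..<length l}. {x \<in> topspace T. f x i = l ! i}))"
    then show "x \<in> {x \<in> topspace T. f x \<in> U}" unfolding L_def by auto
  qed
  also have "\<dots> \<in> Sigma0 T n"
    using n f by (intro Sigma0_UN Sigma0_INT) auto
  finally have S: "{x \<in> topspace T. f x \<in> U} \<in> Sigma0 T n" .
  then have "topspace T - (topspace T - {x \<in> topspace T. f x \<in> U}) \<in> Pi0 T (Suc n)"
    unfolding Pi0_def using Compl_in_Sigma0_Suc[OF n] by blast
  moreover have "topspace T - (topspace T - {x \<in> topspace T. f x \<in> U}) = {x \<in> topspace T. f x \<in> U}"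
    by auto
  ultimately show "{x \<in> topspace T. f x \<in> U} \<in> Delta0 T (Suc n)"
    using S Sigma0_mono_Suc[OF T n] unfolding Delta0_def by auto
qed

lemma Delta0_measurable_compose_continuous:
  assumes "continuous_map S T h" "Delta0_measurable n T R f"
  shows "Delta0_measurable n S R (f \<circ> h)"
  unfolding Delta0_measurable_def
proof (intro conjI allI impI)
  have hT: "h x \<in> topspace T" if "x \<in> topspace S" for x
    using assms(1) that by (auto simp: continuous_map_def)
  show "f \<circ> h \<in> topspace S \<rightarrow> topspace R"
    using hT assms(2) unfolding Delta0_measurable_def by auto
  fix U assume "openin R U"
  then have D: "{x \<in> topspace T. f x \<in> U} \<in> Sigma0 T n" "{x \<in> topspace T. f x \<in> U} \<in> Pi0 T n"
    using assms(2) unfolding Delta0_measurable_def Delta0_def by auto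
  have eq: "{x \<in> topspace S. (f \<circ> h) x \<in> U} = {x \<in> topspace S. h x \<in> {x \<in> topspace T. f x \<in> U}}"
    using hT by auto
  obtain B where B: "{x \<in> topspace T. f x \<in> U} = topspace T - B" "B \<in> Sigma0 T n"
    using D(2) unfolding Pi0_def by blast
  have "{x \<in> topspace S. (f \<circ> h) x \<in> U} = topspace S - {x \<in> topspace S. h x \<in> B}"
    unfolding eq B(1) using hT by auto
  then have "{x \<in> topspace S. (f \<circ> h) x \<in> U} \<in> Pi0 S n"
    unfolding Pi0_def using Sigma0_preimage[OF assms(1) B(2)] by blast
  moreover have "{x \<in> topspace S. (f \<circ> h) x \<in> U} \<in> Sigma0 S n"
    unfolding eq by (rule Sigma0_preimage[OF assms(1) D(1)])
  ultimately show "{x \<in> topspace S. (f \<circ> h) x \<in> U} \<in> Delta0 S n"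
    unfolding Delta0_def by blast
qed

text \<open>\<open>reasonable\<close> speaks only of spaces with points of type
  \<open>nat \<Rightarrow> nat\<close>. The map is therefore moved along \<open>h'\<close> to a
  Polish copy \<open>S\<close> of \<open>T\<close>, where the substitution property applies.\<close>

lemma in_pointclass_Delta0_preimage:
  assumes "reasonable \<Gamma>" "polish T" "Delta0_measurable 6 T baire f" "A \<in> \<Gamma> baire"
  shows "in_pointclass \<Gamma> T {x \<in> topspace T. f x \<in> A}"
proof -
  obtain S :: "(nat \<Rightarrow> nat) topology" and h h'
    where S: "polish S" and h: "homeomorphic_maps T S h h'"
    using polish_copy[OF assms(2)] unfolding homeomorphic_space_def by blast
  have "Delta0_measurable 6 S baire (f \<circ> h')"
    using h assms(3) by (intro Delta0_measurable_compose_continuous) (auto simp: homeomorphic_maps_def)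
  then have "{z \<in> topspace S. (f \<circ> h') z \<in> A} \<in> \<Gamma> S"
    using assms(1,4) S polish_baire unfolding reasonable_def by blast
  moreover have "h ` {x \<in> topspace T. f x \<in> A} = {z \<in> topspace S. (f \<circ> h') z \<in> A}"
  proof (intro equalityI subsetI)
    fix z assume "z \<in> h ` {x \<in> topspace T. f x \<in> A}"
    then show "z \<in> {z \<in> topspace S. (f \<circ> h') z \<in> A}"
      using h unfolding homeomorphic_maps_def continuous_map_def by auto
  next
    fix z assume z: "z \<in> {z \<in> topspace S. (f \<circ> h') z \<in> A}"
    then have "z = h (h' z)" "h' z \<in> topspace T" "f (h' z) \<in> A"
      using h unfolding homeomorphic_maps_def continuous_map_def by auto
    then show "z \<in> h ` {x \<in> topspace T. f x \<in> A}" by blast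
  qed
  moreover have "homeomorphic_map T S h" using h homeomorphic_map_maps by blast
  ultimately have "polish S \<and> homeomorphic_map T S h \<and> h ` {x \<in> topspace T. f x \<in> A} \<in> \<Gamma> S"
    using S by simp
  then show ?thesis unfolding in_pointclass_def by blast
qed

section \<open>Subshifts of finite type\<close>

text \<open>Replaces the list of forbidden words by a local criterion, so that points of
  \<open>X\<close> can be glued from pieces of others. Different windows may come from different
  points.\<close>

definition window_determined :: "int \<Rightarrow> (int \<Rightarrow> bool) set \<Rightarrow> bool" where
  "window_determined N X \<longleftrightarrow>
     (\<forall>y. (\<forall>k. \<exists>x\<in>X. \<exists>i. \<forall>j. 0 \<le> j \<and> j < N \<longrightarrow> y (k + j) = x (i + j)) \<longrightarrow> y \<in> X)"

lemma window_determinedD: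
  assumes "window_determined N X"
    and "\<And>k. \<exists>x\<in>X. \<exists>i. \<forall>j. 0 \<le> j \<and> j < N \<longrightarrow> y (k + j) = x (i + j)"
  shows "y \<in> X"
  using assms unfolding window_determined_def by simp

text \<open>\<open>N\<close> bounds the lengths of the forbidden words: an occurrence of one in
  \<open>y\<close> fits into a single window and would thus also occur in a point of
  \<open>X\<close>.\<close>

lemma subshift_of_finite_type_imp_window_determined:
  assumes "subshift_of_finite_type X"
  obtains N where "window_determined N X"
proof -
  obtain W where W: "finite W" "X = {x. \<forall>w\<in>W. \<not> occurs_in w x}"
    using assms unfolding subshift_of_finite_type_def by blast
  obtain n where n: "\<forall>l\<in>length ` W. l \<le> n"
    using finite_nat_set_iff_bounded_le[of "length ` W"] W(1) by auto
  have "window_determined (int n) X"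
    unfolding window_determined_def
  proof (intro allI impI)
    fix y assume y: "\<forall>k. \<exists>x\<in>X. \<exists>i. \<forall>j. 0 \<le> j \<and> j < int n \<longrightarrow> y (k + j) = x (i + j)"
    have "\<not> occurs_in w y" if w: "w \<in> W" for w
    proof
      assume "occurs_in w y"
      then obtain k where k: "\<And>j. j < length w \<Longrightarrow> y (k + int j) = w ! j"
        unfolding occurs_in_def by blast
      obtain x i where x: "x \<in> X" "\<And>j. 0 \<le> j \<Longrightarrow> j < int n \<Longrightarrow> y (k + j) = x (i + j)"
        using y by blast
      have "x (i + int j) = w ! j" if "j < length w" for j
        using k[OF that] x(2)[of "int j"] that n w by force
      then have "occurs_in w x" unfolding occurs_in_def by blast
      then show False using x(1) w W(2) by blast
    qed
    then show "y \<in> X" using W(2) by blast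
  qed
  then show thesis by (rule that)
qed

lemma window_determined_shift:
  assumes "window_determined N X" "x \<in> X"
  shows "(\<lambda>k. x (m + k)) \<in> X"
proof (rule window_determinedD[OF assms(1)])
  fix k
  have "\<forall>j. 0 \<le> j \<and> j < N \<longrightarrow> x (m + (k + j)) = x (m + k + j)" by (simp add: add.assoc)
  then show "\<exists>z\<in>X. \<exists>i. \<forall>j. 0 \<le> j \<and> j < N \<longrightarrow> x (m + (k + j)) = z (i + j)"
    using assms(2) by blast
qed

text \<open>The window at a block boundary may run across several blocks, as \<open>N\<close> may
  exceed \<open>q\<close>. Inside the window \<open>a\<close> has period \<open>q\<close>, so an
  offset \<open>j \<ge> q\<close> reduces to the offset \<open>j - q\<close> at the next
  boundary.\<close>

lemma concat_blocks_window:
  fixes f :: "'b \<Rightarrow> int \<Rightarrow> bool"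
  assumes "q > 0"
    and a: "\<And>b j. 0 \<le> j \<Longrightarrow> j < N \<Longrightarrow> f b j = a j \<and> f b (q + j) = a j"
    and "0 \<le> j" "j < N"
  shows "f (c ((d * q + j) div q)) ((d * q + j) mod q) = a j"
  using assms(3,4)
proof (induction "nat j" arbitrary: j d rule: less_induct)
  case less
  show ?case
  proof (cases "j < q")
    case True
    then show ?thesis using a less.prems assms(1) by simp
  next
    case False
    then have j: "0 \<le> j - q" "j - q < N" "nat (j - q) < nat j" using assms(1) less.prems by auto
    have "d * q + j = (d + 1) * q + (j - q)" by (simp add: algebra_simps)
    then have "f (c ((d * q + j) div q)) ((d * q + j) mod q) = a (j - q)"
      using less.hyps[OF j(3,1,2), of "d + 1"] by presburger
    also have "\<dots> = a j" using a[OF j(1,2)] a[OF less.prems] by auto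
    finally show ?thesis .
  qed
qed

text \<open>The window at \<open>k\<close> also occurs in the single point
  \<open>f (c (k div q))\<close>, starting at \<open>k mod q\<close>: beyond the end of the block
  both sequences read \<open>a\<close>.\<close>

lemma concat_blocks_in:
  fixes f :: "'b \<Rightarrow> int \<Rightarrow> bool"
  assumes X: "window_determined N X" and q: "q > 0" and f: "\<And>b. f b \<in> X"
    and a: "\<And>b j. 0 \<le> j \<Longrightarrow> j < N \<Longrightarrow> f b j = a j \<and> f b (q + j) = a j"
  shows "(\<lambda>k. f (c (k div q)) (k mod q)) \<in> X"
proof -
  have "f (c ((k + j) div q)) ((k + j) mod q) = f (c (k div q)) (k mod q + j)"
    if j: "0 \<le> j" "j < N" for k j
  proof (cases "k mod q + j < q")
    case True
    have "(k + j) div q = k div q" "(k + j) mod q = k mod q + j"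
      using int_div_pos_eq[of "k + j" q "k div q" "k mod q + j"]
        int_mod_pos_eq[of "k + j" q "k div q" "k mod q + j"] True q j by simp_all
    then show ?thesis by simp
  next
    case False
    define t where "t = k mod q + j - q"
    have t: "0 \<le> t" "t < N" using False j pos_mod_bound[OF q, of k] unfolding t_def by linarith+
    have "k + j = (k div q + 1) * q + t" by (simp add: t_def algebra_simps)
    then have "f (c ((k + j) div q)) ((k + j) mod q) = a t"
      using concat_blocks_window[where f = f and a = a and c = c and d = "k div q + 1", OF q a t] by presburger
    also have "\<dots> = f (c (k div q)) (q + t)" using a[OF t] by auto
    finally show ?thesis by (simp add: t_def)
  qed
  then show ?thesis using f by (intro window_determinedD[OF X]) blast
qed

text \<open>Agreement of the windows at 0 and at \<open>q\<close> says that both paths leave a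
  common vertex and return to it after \<open>q\<close> steps. The negation supplies exactly the
  blocks \<open>u\<close> and \<open>v\<close> of the coding.\<close>

definition unique_returns :: "int \<Rightarrow> (int \<Rightarrow> bool) set \<Rightarrow> bool" where
  "unique_returns N X \<longleftrightarrow> (\<forall>q>0. \<forall>x\<in>X. \<forall>x'\<in>X.
     (\<forall>j. 0 \<le> j \<and> j < N \<longrightarrow> x' j = x j \<and> x (q + j) = x j \<and> x' (q + j) = x j) \<longrightarrow>
     (\<forall>k. 0 \<le> k \<and> k < q \<longrightarrow> x k = x' k))"

section \<open>Countability of \<open>X\<close> when return paths are unique\<close>

lemma unique_returnsD:
  assumes "unique_returns N X" "q > 0" "x \<in> X" "x' \<in> X"
    and "\<And>j. 0 \<le> j \<Longrightarrow> j < N \<Longrightarrow> x' j = x j \<and> x (q + j) = x j \<and> x' (q + j) = x j"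
    and "0 \<le> k" "k < q"
  shows "x k = x' k"
  using assms unfolding unique_returns_def by blast

text \<open>The periodic extensions of the block from \<open>i0\<close> to \<open>i1\<close> and of the block from \<open>i\<close> to
  \<open>i'\<close> both return to the window after \<open>(i1 - i0) * (i' - i)\<close> steps, so they coincide.\<close>

lemma recurrence_periodic:
  assumes X: "window_determined N X"
    and unique: "unique_returns N X"
    and x: "x \<in> X" and less: "i0 < i1" "i < i'"
    and a: "\<And>t. 0 \<le> t \<Longrightarrow> t < N \<Longrightarrow> x (i0 + t) = a t \<and> x (i1 + t) = a t \<and> x (i + t) = a t \<and> x (i' + t) = a t"
    and k: "i \<le> k" "k + (i1 - i0) < i'"
  shows "x (k + (i1 - i0)) = x k"
proof -
  define L where "L = i1 - i0"
  define M where "M = i' - i"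
  define P where "P k = x (i0 + k mod L)" for k
  define P' where "P' k = x (i + k mod M)" for k
  have LM: "L > 0" "M > 0" using less by (auto simp: L_def M_def)
  have aL: "x (i0 + t) = a t \<and> x (i0 + (L + t)) = a t" if "0 \<le> t" "t < N" for t
    using a[OF that] by (simp add: L_def)
  have aM: "x (i + t) = a t \<and> x (i + (M + t)) = a t" if "0 \<le> t" "t < N" for t
    using a[OF that] by (simp add: M_def)
  \<comment> \<open>Periodic repetition is concatenation with a single block, hence the label type
    \<open>unit\<close>.\<close>
  have "(\<lambda>k. x (i0 + k mod L)) \<in> X"
    by (rule concat_blocks_in[OF X LM(1), of "\<lambda>_::unit. \<lambda>k. x (i0 + k)" a])
       (use aL window_determined_shift[OF X x] in auto)
  then have PX: "P \<in> X" by (simp add: P_def[abs_def])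
  have "(\<lambda>k. x (i + k mod M)) \<in> X"
    by (rule concat_blocks_in[OF X LM(2), of "\<lambda>_::unit. \<lambda>k. x (i + k)" a])
       (use aM window_determined_shift[OF X x] in auto)
  then have P'X: "P' \<in> X" by (simp add: P'_def[abs_def])
  have Pa: "P t = a t" if "0 \<le> t" "t < N" for t
    using concat_blocks_window[OF LM(1), of N "\<lambda>_::unit. \<lambda>k. x (i0 + k)" a t "\<lambda>_. ()" 0] aL that
    by (simp add: P_def)
  have P'a: "P' t = a t" if "0 \<le> t" "t < N" for t
    using concat_blocks_window[OF LM(2), of N "\<lambda>_::unit. \<lambda>k. x (i + k)" a t "\<lambda>_. ()" 0] aM that
    by (simp add: P'_def)
  have per: "P (L * M + t) = P t" "P' (L * M + t) = P' t" for t
    by (simp_all add: P_def P'_def)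
  have PP': "P t = P' t" if "0 \<le> t" "t < L * M" for t
  proof (rule unique_returnsD[OF unique _ PX P'X _ that])
    show "L * M > 0" using LM by simp
    show "P' j = P j \<and> P (L * M + j) = P j \<and> P' (L * M + j) = P j" if "0 \<le> j" "j < N" for j
      using Pa[OF that] P'a[OF that] per by simp
  qed
  \<comment> \<open>The agreement of \<open>P\<close> and \<open>P'\<close> thus covers the whole
    block of length \<open>M\<close>, where \<open>x\<close> inherits the period \<open>L\<close> of
    \<open>P\<close>.\<close>
  have le: "M \<le> L * M" using LM by (simp add: mult_le_cancel_right1)
  have xP: "x (i + t) = P t" if "0 \<le> t" "t < M" for t
    using PP'[OF that(1) less_le_trans[OF that(2) le]] that by (simp add: P'_def)
  have "x (k + L) = P (k - i + L)"
    using xP[of "k - i + L"] k LM by (simp add: L_def M_def)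
  also have "\<dots> = P (k - i)" by (simp add: P_def)
  also have "\<dots> = x k" using xP[of "k - i"] k LM by (simp add: L_def M_def)
  finally show ?thesis by (simp add: L_def)
qed

text \<open>Such a sequence is determined by its values on \<open>{m - L'..n + L}\<close>: the
  period \<open>L\<close> propagates them to the right, then \<open>L'\<close> to the left.\<close>

lemma finite_eventually_periodic:
  assumes "m \<le> n" "L > 0" "L' > 0"
  shows "finite {x :: int \<Rightarrow> bool. (\<forall>k\<ge>n. x (k + L) = x k) \<and> (\<forall>k. k + L' < m \<longrightarrow> x (k + L') = x k)}"
    (is "finite ?S")
proof -
  define r where "r x = {k \<in> {m - L'..n + L}. x k}" for x :: "int \<Rightarrow> bool"
  have "inj_on r ?S"
  proof (rule inj_onI)
    fix x y assume x: "x \<in> ?S" and y: "y \<in> ?S" and eq: "r x = r y"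
    have mid: "x k = y k" if "m - L' \<le> k" "k \<le> n + L" for k
      using eq that unfolding r_def by (auto simp: set_eq_iff)
    have up: "x k = y k" if "m - L' \<le> k" for k
      using that
    proof (induction "nat (k - (m - L'))" arbitrary: k rule: less_induct)
      case less
      show ?case
      proof (cases "k \<le> n + L")
        case True
        then show ?thesis using mid less.prems by simp
      next
        case False
        then have "x (k - L) = y (k - L)" using less.hyps[of "k - L"] assms by simp
        moreover have "k - L \<ge> n" using False by simp
        then have "x (k - L + L) = x (k - L)" "y (k - L + L) = y (k - L)"
          using x y by blast+
        ultimately show ?thesis by simp
      qed
    qed
    have "x k = y k" for k
    proof (induction "nat (m - k)" arbitrary: k rule: less_induct)
      case less
      show ?case
      proof (cases "m - L' \<le> k")
        case True
        then show ?thesis by (rule up)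
      next
        case False
        then have "x (k + L') = y (k + L')" using less.hyps[of "k + L'"] assms by simp
        moreover have "x (k + L') = x k" "y (k + L') = y k"
          using x y False by (auto simp: less_diff_eq)
        ultimately show ?thesis by simp
      qed
    qed
    then show "x = y" ..
  qed
  moreover have "finite (r ` ?S)"
    by (rule finite_subset[of _ "Pow {m - L'..n + L}"]) (auto simp: r_def)
  ultimately show ?thesis using finite_imageD by blast
qed

text \<open>Pigeonhole: there are only finitely many windows of length \<open>N\<close>.\<close>

lemma recurrent_window:
  fixes x :: "int \<Rightarrow> bool"
  assumes "infinite S"
  obtains I a where "I \<subseteq> S" "infinite I" "\<And>i t. i \<in> I \<Longrightarrow> 0 \<le> t \<Longrightarrow> t < N \<Longrightarrow> x (i + t) = a t"
proof -
  define w where "w i = {t \<in> {0..<N}. x (i + t)}" for i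
  have "finite (w ` S)" by (rule finite_subset[of _ "Pow {0..<N}"]) (auto simp: w_def)
  then obtain i0 where i0: "i0 \<in> S" "infinite {i \<in> S. w i = w i0}"
    using pigeonhole_infinite[OF assms] by blast
  show thesis
  proof (rule that)
    show "{i \<in> S. w i = w i0} \<subseteq> S" by blast
    show "infinite {i \<in> S. w i = w i0}" by (rule i0(2))
    show "x (i + t) = (t \<in> w i0)" if "i \<in> {i \<in> S. w i = w i0}" "0 \<le> t" "t < N" for i t
    proof -
      have "w i = w i0" using that(1) by blast
      then have "t \<in> w i \<longleftrightarrow> t \<in> w i0" by (rule arg_cong)
      then show ?thesis using that(2,3) by (simp add: w_def)
    qed
  qed
qed

lemma infinite_int_two:
  assumes "infinite (I :: int set)"
  obtains i j where "i \<in> I" "j \<in> I" "i < j"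
proof -
  obtain i where i: "i \<in> I" using infinite_imp_nonempty[OF assms] by blast
  have "infinite (I - {i})" using assms by simp
  then obtain j where "j \<in> I - {i}" using infinite_imp_nonempty by blast
  then show thesis using that i by (cases "i < j") auto
qed

text \<open>A window recurring infinitely often to the right forces a period there, and likewise to
  the left. Points periodic at both ends form countably many finite families, indexed by four
  integers.\<close>

lemma unique_returns_imp_countable:
  assumes X: "window_determined N X"
    and unique: "unique_returns N X"
  shows "countable X"
proof -
  define S where "S = (\<lambda>(n, L, m, L'). {x :: int \<Rightarrow> bool. m \<le> n \<and> L > 0 \<and> L' > 0 \<and>
      (\<forall>k\<ge>n. x (k + L) = x k) \<and> (\<forall>k. k + L' < m \<longrightarrow> x (k + L') = x k)})"
  have "finite (S p)" for p
  proof -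
    obtain n L m L' where p: "p = (n, L, m, L')" by (cases p) auto
    show ?thesis
    proof (cases "m \<le> n \<and> L > 0 \<and> L' > 0")
      case True
      then show ?thesis using finite_eventually_periodic[of m n L L'] by (simp add: S_def p)
    next
      case False
      then have "S p = {}" by (auto simp: S_def p)
      then show ?thesis by simp
    qed
  qed
  then have "countable (\<Union>p. S p)" by (simp add: countable_finite)
  moreover have "X \<subseteq> (\<Union>p. S p)"
  proof
    fix x assume x: "x \<in> X"
    obtain I a where I: "I \<subseteq> {0..}" "infinite I"
      "\<And>i t. i \<in> I \<Longrightarrow> 0 \<le> t \<Longrightarrow> t < N \<Longrightarrow> x (i + t) = a t"
      using recurrent_window[of "{0::int..}" N x] infinite_Ici by blast
    obtain i0 i1 where i: "i0 \<in> I" "i1 \<in> I" "i0 < i1" using infinite_int_two[OF I(2)] .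
    have up: "x (k + (i1 - i0)) = x k" if "k \<ge> i0" for k
    proof -
      \<comment> \<open>An infinite set of nonnegative positions is unbounded above, so a recurrence
        \<open>i'\<close> beyond any given \<open>k\<close> can close the block starting at
        \<open>i0\<close>.\<close>
      have "\<not> I \<subseteq> {0..k + (i1 - i0)}" using I(2) finite_subset by blast
      then obtain i' where i': "i' \<in> I" "k + (i1 - i0) < i'" using I(1) by force
      show ?thesis
        by (rule recurrence_periodic[OF X unique x i(3), where a = a and i = i0 and i' = i'])
          (use i i' that I(3) in auto)
    qed
    obtain J b where J: "J \<subseteq> {..0}" "infinite J"
      "\<And>i t. i \<in> J \<Longrightarrow> 0 \<le> t \<Longrightarrow> t < N \<Longrightarrow> x (i + t) = b t"
      using recurrent_window[of "{..0::int}" N x] infinite_Iic by blast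
    obtain j0 j1 where j: "j0 \<in> J" "j1 \<in> J" "j0 < j1" using infinite_int_two[OF J(2)] .
    have down: "x (k + (j1 - j0)) = x k" if "k + (j1 - j0) < j1" for k
    proof -
      have "\<not> J \<subseteq> {k..0}" using J(2) finite_subset by blast
      then obtain i' where i': "i' \<in> J" "i' < k" using J(1) by force
      show ?thesis
        by (rule recurrence_periodic[OF X unique x j(3), where a = b and i = i' and i' = j1])
          (use j i' that J(3) in auto)
    qed
    \<comment> \<open>The two recurrence sets lie on opposite sides of 0; this gives the condition
      \<open>m \<le> n\<close> in \<open>S\<close>.\<close>
    have "j1 \<le> i0" using i j I(1) J(1) by force
    then have "x \<in> S (i0, i1 - i0, j1, j1 - j0)"
      using up down i j by (simp add: S_def)
    then show "x \<in> (\<Union>p. S p)" by blast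
  qed
  ultimately show ?thesis using countable_subset by blast
qed

lemma closedin_subshift_of_finite_type:
  assumes "subshift_of_finite_type X"
  shows "closedin cantorZ X"
proof -
  obtain W where W: "X = {x. \<forall>w\<in>W. \<not> occurs_in w x}"
    using assms unfolding subshift_of_finite_type_def by blast
  have "openin cantorZ (UNIV - X)"
    unfolding cantorZ_def openin_product_discrete_iff
  proof
    fix x assume "x \<in> UNIV - X"
    then obtain w i where w: "w \<in> W" "\<And>j. j < length w \<Longrightarrow> x (i + int j) = w ! j"
      unfolding W occurs_in_def by blast
    have "y \<in> UNIV - X" if "\<forall>k\<in>(\<lambda>j. i + int j) ` {..<length w}. y k = x k" for y
    proof -
      have "occurs_in w y" unfolding occurs_in_def using that w(2) by auto
      then show ?thesis using w(1) W by blast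
    qed
    then show "\<exists>F. finite F \<and> (\<forall>y. (\<forall>i\<in>F. y i = x i) \<longrightarrow> y \<in> UNIV - X)"
      by (intro exI[of _ "(\<lambda>j. i + int j) ` {..<length w}"]) simp
  qed
  then show ?thesis by (simp add: closedin_def)
qed

section \<open>Closed sets as continuous images of the Baire space\<close>

text \<open>\<open>int_decode\<close> lists the coordinates in one sequence, so that points of the
  two-sided shift can be compared by initial segments.\<close>

definition agree :: "nat \<Rightarrow> (int \<Rightarrow> bool) \<Rightarrow> (int \<Rightarrow> bool) \<Rightarrow> bool" where
  "agree n s x \<longleftrightarrow> (\<forall>k<n. s (int_decode k) = x (int_decode k))"

lemma agree_mono: "agree n s x \<Longrightarrow> m \<le> n \<Longrightarrow> agree m s x"
  by (simp add: agree_def)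

lemma agree_sym: "agree n s x \<Longrightarrow> agree n x s"
  by (simp add: agree_def)

lemma agree_trans: "agree n s x \<Longrightarrow> agree n x y \<Longrightarrow> agree n s y"
  by (simp add: agree_def)

lemma agree_cong: "agree n s t \<Longrightarrow> agree n s x \<longleftrightarrow> agree n t x"
  by (simp add: agree_def)

lemma closed_cantorZ_agree:
  assumes "closedin cantorZ X" "\<And>n. \<exists>x\<in>X. agree n s x"
  shows "s \<in> X"
proof (rule ccontr)
  assume "s \<notin> X"
  then have s: "s \<in> UNIV - X" by simp
  have "openin cantorZ (UNIV - X)" using assms(1) by (simp add: closedin_def)
  then have "\<exists>F. finite F \<and> (\<forall>y. (\<forall>i\<in>F. y i = s i) \<longrightarrow> y \<in> UNIV - X)"
    unfolding cantorZ_def openin_product_discrete_iff using s by (rule bspec)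
  then obtain F where F: "finite F" "\<forall>y. (\<forall>i\<in>F. y i = s i) \<longrightarrow> y \<in> UNIV - X" by blast
  have "finite (int_encode ` F)" using F(1) by simp
  then obtain n where n: "\<forall>k\<in>int_encode ` F. k < n"
    unfolding finite_nat_set_iff_bounded ..
  obtain x where x: "x \<in> X" "agree n s x" using assms(2) by blast
  have "x i = s i" if "i \<in> F" for i
  proof -
    have "int_encode i < n" using n that by blast
    then have "s (int_decode (int_encode i)) = x (int_decode (int_encode i))"
      using x(2) unfolding agree_def by blast
    then show ?thesis by simp
  qed
  then show False using F(2) x(1) by blast
qed

text \<open>A point outside \<open>X\<close> is retracted to a point of \<open>X\<close> that depends only on the longest initial
  segment that is compatible with \<open>X\<close>.\<close>

lemma closed_cantorZ_retraction:
  assumes X: "closedin cantorZ X" "X \<noteq> {}"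
  obtains r where "\<And>s. r s \<in> X" "\<And>s. s \<in> X \<Longrightarrow> r s = s"
    "\<And>n s t. agree n s t \<Longrightarrow> agree n (r s) (r t)"
proof -
  define good where "good n s \<longleftrightarrow> (\<exists>x\<in>X. agree n s x)" for n s
  \<comment> \<open>For \<open>s\<close> outside \<open>X\<close>, the length of the longest
    compatible initial segment. The empty one is compatible because \<open>X\<close> is nonempty,
    which justifies \<open>Suc\<close>.\<close>
  define m where "m s = (LEAST n. \<not> good (Suc n) s)" for s
  define r where "r s = (if s \<in> X then s else SOME x. x \<in> X \<and> agree (m s) s x)" for s
  have good_mono: "good k s" if "good n s" "k \<le> n" for n k s
    using that agree_mono unfolding good_def by blast
  have good_cong: "good n s \<longleftrightarrow> good n t" if "agree n s t" for n s t
    using agree_cong[OF that] unfolding good_def by simp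
  have good0: "good 0 s" for s using X(2) by (auto simp: good_def agree_def)
  have out: "good (m s) s \<and> \<not> good (Suc (m s)) s" if s: "s \<notin> X" for s
  proof -
    obtain n where n: "\<not> good n s" using closed_cantorZ_agree[OF X(1), of s] s unfolding good_def by blast
    then obtain n' where "n = Suc n'" using good0 by (cases n) auto
    then have ex: "\<not> good (Suc n') s" using n by simp
    have 1: "\<not> good (Suc (m s)) s" unfolding m_def by (rule LeastI[of "\<lambda>n. \<not> good (Suc n) s", OF ex])
    have "good (m s) s"
    proof (cases "m s")
      case 0
      then show ?thesis using good0 by simp
    next
      case (Suc k)
      then have "k < (LEAST n. \<not> good (Suc n) s)" unfolding m_def by simp
      then have "good (Suc k) s" using not_less_Least by blast
      then show ?thesis using Suc by simp
    qed
    then show ?thesis using 1 by blast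
  qed
  have r_out: "r s \<in> X \<and> agree (m s) s (r s)" if "s \<notin> X" for s
  proof -
    have "\<exists>x. x \<in> X \<and> agree (m s) s x" using out[OF that] unfolding good_def by blast
    then have "(SOME x. x \<in> X \<and> agree (m s) s x) \<in> X \<and> agree (m s) s (SOME x. x \<in> X \<and> agree (m s) s x)"
      by (rule someI_ex)
    then show ?thesis using that by (simp add: r_def)
  qed
  have close: "agree n s (r s)" if "good n s" for n s
  proof (cases "s \<in> X")
    case True
    then show ?thesis by (simp add: r_def agree_def)
  next
    case False
    have "n \<le> m s" using out[OF False] that good_mono[of n s "Suc (m s)"] by linarith
    then show ?thesis using r_out[OF False] agree_mono by blast
  qed
  \<comment> \<open>Once an initial segment is incompatible with \<open>X\<close>, it already fixes
    the retracted point.\<close>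
  have eq: "r s = r t" if st: "agree n s t" and bad: "\<not> good n s" for n s t
  proof -
    have notin: "s \<notin> X" "t \<notin> X"
      using bad good_cong[OF st] unfolding good_def by (auto simp: agree_def)
    have less: "m s < n" "m t < n"
      using out[OF notin(1)] out[OF notin(2)] bad good_cong[OF st] good_mono by (meson not_less)+
    have iff: "good k s \<longleftrightarrow> good k t" if "k \<le> n" for k
      by (rule good_cong[OF agree_mono[OF st that]])
    have "\<not> good (Suc (m s)) t" "\<not> good (Suc (m t)) s"
      using iff[of "Suc (m s)"] iff[of "Suc (m t)"] out[OF notin(1)] out[OF notin(2)] less by auto
    then have "m t \<le> m s" "m s \<le> m t" unfolding m_def by (auto intro: Least_le)
    then have mm: "m s = m t" by simp
    have "agree (m s) s t" using agree_mono[OF st] less by simp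
    \<comment> \<open>Equality as predicates makes the choice operator select the same point for
      \<open>s\<close> and \<open>t\<close>.\<close>
    then have "agree (m s) s = agree (m t) t" using agree_cong mm by (intro ext) simp
    then show ?thesis using notin by (simp add: r_def)
  qed
  show thesis
  proof (rule that)
    show "r s \<in> X" for s using r_out by (cases "s \<in> X") (auto simp: r_def)
    show "r s = s" if "s \<in> X" for s using that by (simp add: r_def)
    show "agree n (r s) (r t)" if "agree n s t" for n s t
    proof (cases "good n s")
      case True
      then have "good n t" using good_cong[OF that] by simp
      then show ?thesis
        using close[OF True] close[of n t] that agree_sym agree_trans by blast
    next
      case False
      then show ?thesis using eq[OF that] by (simp add: agree_def)
    qed
  qed
qed

text \<open>Taking parities maps the Baire space onto all of \<open>cantorZ\<close>, and the
  retraction maps that onto \<open>X\<close>. Coordinate \<open>i\<close> of the result depends only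
  on the first \<open>Suc (int_encode i)\<close> entries.\<close>

lemma closed_cantorZ_baire_surjection:
  assumes "closedin cantorZ X" "X \<noteq> {}"
  obtains \<psi> where "continuous_map baire (subtopology cantorZ X) \<psi>" "range \<psi> = X"
proof -
  obtain r where r: "\<And>s. r s \<in> X" "\<And>s. s \<in> X \<Longrightarrow> r s = s"
    "\<And>n s t. agree n s t \<Longrightarrow> agree n (r s) (r t)"
    using closed_cantorZ_retraction[OF assms] by blast
  define b :: "(nat \<Rightarrow> nat) \<Rightarrow> int \<Rightarrow> bool" where "b y i = odd (y (int_encode i))" for y i
  have "continuous_map baire cantorZ (\<lambda>y. r (b y))"
  proof (rule continuous_map_baire_cantorZ)
    fix x :: "nat \<Rightarrow> nat" and i
    have "r (b y) i = r (b x) i" if "\<forall>k<Suc (int_encode i). y k = x k" for y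
    proof -
      have "agree (Suc (int_encode i)) (b y) (b x)"
        unfolding agree_def b_def using that by simp
      then have "agree (Suc (int_encode i)) (r (b y)) (r (b x))" by (rule r(3))
      then have "r (b y) (int_decode (int_encode i)) = r (b x) (int_decode (int_encode i))"
        unfolding agree_def by blast
      then show ?thesis by simp
    qed
    then show "\<exists>n. \<forall>y. (\<forall>k<n. y k = x k) \<longrightarrow> r (b y) i = r (b x) i" by blast
  qed
  then have "continuous_map baire (subtopology cantorZ X) (\<lambda>y. r (b y))"
    using r(1) by (simp add: continuous_map_in_subtopology)
  moreover have "range (\<lambda>y. r (b y)) = X"
  proof (intro equalityI subsetI)
    fix x assume x: "x \<in> X"
    have "b (\<lambda>k. if x (int_decode k) then 1 else 0) = x" by (rule ext) (simp add: b_def)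
    then show "x \<in> range (\<lambda>y. r (b y))" using r(2)[OF x] by (metis rangeI)
  qed (use r(1) in auto)
  ultimately show thesis by (rule that)
qed

section \<open>Coding the Baire space\<close>

definition first_break :: "int \<Rightarrow> (int \<Rightarrow> bool) \<Rightarrow> int \<Rightarrow> bool" where
  "first_break q x i \<longleftrightarrow> x i \<noteq> x (i - q) \<and> (\<forall>j<i. x j = x (j - q))"

text \<open>In an encoded point \<open>x (i - q)\<close> is a letter of \<open>u\<close>, and the
  summand 1 skips the marker block \<open>v\<close> containing the break. Block \<open>l + 1\<close>
  is thus tested for being \<open>v\<close>.\<close>

definition coded :: "int \<Rightarrow> (int \<Rightarrow> bool) \<Rightarrow> nat \<Rightarrow> bool" where
  "coded q x l \<longleftrightarrow> (\<exists>i. first_break q x i \<and> x (i + (1 + int l) * q) \<noteq> x (i - q))"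

text \<open>The coded set of naturals is meant to be the graph of the decoded function.\<close>

definition decode :: "int \<Rightarrow> (int \<Rightarrow> bool) \<Rightarrow> nat \<Rightarrow> nat" where
  "decode q x n =
     (if \<exists>m. coded q x (prod_encode (n, m)) then LEAST m. coded q x (prod_encode (n, m)) else 0)"

text \<open>The block \<open>u\<close> repeated up to position 0, then \<open>v\<close>, then the blocks \<open>u\<close> and \<open>v\<close> in the order
  of the characteristic function of the graph of \<open>y\<close>.\<close>

definition encode :: "int \<Rightarrow> (int \<Rightarrow> bool) \<Rightarrow> (int \<Rightarrow> bool) \<Rightarrow> (nat \<Rightarrow> nat) \<Rightarrow> int \<Rightarrow> bool" where
  "encode q u v y k =
     (if k div q = 0 \<or> k div q > 0 \<and> (case prod_decode (nat (k div q - 1)) of (n, m) \<Rightarrow> y n = m)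
      then v else u) (k mod q)"

lemma first_break_unique: "first_break q x i \<Longrightarrow> first_break q x i' \<Longrightarrow> i = i'"
  unfolding first_break_def by (metis linorder_neqE)

lemma first_break_shift:
  assumes "\<And>k. y k = x (k + m)"
  shows "first_break q y i \<longleftrightarrow> first_break q x (i + m)"
proof -
  have eq: "j - q + m = j + m - q" for j by simp
  have "(\<forall>j<i. x (j + m) = x (j + m - q)) \<longleftrightarrow> (\<forall>j<i + m. x j = x (j - q))"
  proof
    assume *: "\<forall>j<i. x (j + m) = x (j + m - q)"
    show "\<forall>j<i + m. x j = x (j - q)"
    proof (rule allI, rule impI)
      fix j assume "j < i + m"
      then have "j - m < i" by simp
      with * have "x (j - m + m) = x (j - m + m - q)" by blast
      then show "x j = x (j - q)" by simp
    qed
  next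
    assume *: "\<forall>j<i + m. x j = x (j - q)"
    show "\<forall>j<i. x (j + m) = x (j + m - q)"
    proof (rule allI, rule impI)
      fix j assume "j < i"
      then have "j + m < i + m" by simp
      with * show "x (j + m) = x (j + m - q)" by blast
    qed
  qed
  then show ?thesis unfolding first_break_def assms eq by simp
qed

text \<open>The break and all coordinates read relative to it move together by \<open>m\<close>.
  This makes the preimage of any set under \<open>decode q\<close> invariant.\<close>

lemma decode_shift:
  assumes "\<And>k. y k = x (k + m)"
  shows "decode q y = decode q x"
proof -
  have "coded q y l \<longleftrightarrow> coded q x l" for l
  proof -
    have "y (i - q) = x (i + m - q)" "y (i + (1 + int l) * q) = x (i + m + (1 + int l) * q)" for i
      using assms[of "i - q"] assms[of "i + (1 + int l) * q"] by (simp_all add: algebra_simps)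
    then have "coded q y l \<longleftrightarrow>
        (\<exists>i. first_break q x (i + m) \<and> x (i + m + (1 + int l) * q) \<noteq> x (i + m - q))"
      using first_break_shift[where y = y and x = x and m = m, OF assms] by (simp add: coded_def)
    also have "\<dots> \<longleftrightarrow> coded q x l"
      unfolding coded_def by (metis diff_add_cancel)
    finally show ?thesis .
  qed
  then show ?thesis by (intro ext) (simp add: decode_def)
qed

section \<open>Borel complexity of the decoding map\<close>

lemma closedin_cantorZ_two_coordinates: "closedin cantorZ {x. P (x a) (x b)}"
proof -
  have "openin cantorZ (UNIV - {x. P (x a) (x b)})"
    unfolding cantorZ_def openin_product_discrete_iff
    by (intro ballI exI[of _ "{a, b}"]) simp
  then show ?thesis by (simp add: closedin_def)
qed

lemma metrizable_cantorZ: "metrizable_space cantorZ"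
  unfolding cantorZ_def
  by (intro completely_metrizable_imp_metrizable_space completely_metrizable_product_discrete)

text \<open>For a fixed break position the condition is closed, being a conjunction of conditions on
  two coordinates each; there are countably many positions.\<close>

lemma coded_Sigma0: "{x. coded q x l} \<in> Sigma0 cantorZ 2"
proof -
  have "closedin cantorZ {x. first_break q x i \<and> x (i + (1 + int l) * q) \<noteq> x (i - q)}" for i
  proof -
    have "{x. first_break q x i \<and> x (i + (1 + int l) * q) \<noteq> x (i - q)} =
      {x. x i \<noteq> x (i - q)} \<inter> (\<Inter>j\<in>{..<i}. {x. x j = x (j - q)}) \<inter>
      {x. x (i + (1 + int l) * q) \<noteq> x (i - q)}"
      by (auto simp: first_break_def)
    also have "closedin cantorZ \<dots>"
      by (intro closedin_Int closedin_INT closedin_cantorZ_two_coordinates) auto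
    finally show ?thesis .
  qed
  then have "(\<Union>i. {x. first_break q x i \<and> x (i + (1 + int l) * q) \<noteq> x (i - q)}) \<in> Sigma0 cantorZ 2"
    by (intro Sigma0_UN closedin_in_Sigma0 metrizable_cantorZ) auto
  moreover have "(\<Union>i. {x. first_break q x i \<and> x (i + (1 + int l) * q) \<noteq> x (i - q)}) = {x. coded q x l}"
    by (auto simp: coded_def)
  ultimately show ?thesis by simp
qed

text \<open>The fibres of each value are finite combinations of sets at level 2 and their
  complements at level 3. All are lifted to level 5, so that the resulting measurability has the
  level 6 of \<open>reasonable\<close>.\<close>

lemma decode_measurable: "Delta0_measurable 6 (subtopology cantorZ X) baire (decode q)"
proof -
  define C where "C n m = {x. coded q x (prod_encode (n, m))}" for n m
  have C2: "C n m \<in> Sigma0 cantorZ 2" for n m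
    unfolding C_def by (rule coded_Sigma0)
  have up: "B \<in> Sigma0 cantorZ 5" if "B \<in> Sigma0 cantorZ k" "1 \<le> k" "k \<le> 5" for B k
    using Sigma0_mono[OF metrizable_cantorZ that(2,3)] that(1) by blast
  have C: "C n m \<in> Sigma0 cantorZ 5" for n m by (rule up[OF C2]) auto
  have compl: "UNIV - B \<in> Sigma0 cantorZ 5" if "B \<in> Sigma0 cantorZ 2" for B
    using Compl_in_Sigma0_Suc[of 2 B cantorZ] that by (intro up[of _ "Suc 2"]) auto
  have "{x \<in> topspace cantorZ. decode q x n = m} \<in> Sigma0 cantorZ 5" for n m
  proof -
    \<comment> \<open>The default value of \<open>decode\<close>: points that code no value at
      \<open>n\<close> join the fibre over 0.\<close>
    define Z where "Z = (if m = 0 then UNIV - (\<Union>j. C n j) else {})"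
    have "(\<Union>j. C n j) \<in> Sigma0 cantorZ 2" by (intro Sigma0_UN C2) auto
    then have "Z \<in> Sigma0 cantorZ 5"
      using compl empty_in_Sigma0[of 5 cantorZ] by (simp add: Z_def)
    moreover have "topspace cantorZ \<inter> (\<Inter>j\<in>{..<m}. UNIV - C n j) \<in> Sigma0 cantorZ 5"
      by (intro Sigma0_INT compl C2) auto
    then have "C n m \<inter> (topspace cantorZ \<inter> (\<Inter>j\<in>{..<m}. UNIV - C n j)) \<in> Sigma0 cantorZ 5"
      by (rule Sigma0_Int[OF _ C, rotated]) simp
    ultimately have "C n m \<inter> (topspace cantorZ \<inter> (\<Inter>j\<in>{..<m}. UNIV - C n j)) \<union> Z \<in> Sigma0 cantorZ 5"
      by (intro Sigma0_Un) simp_all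
    moreover have "decode q x n = m \<longleftrightarrow> x \<in> C n m \<inter> (\<Inter>j\<in>{..<m}. UNIV - C n j) \<union> Z" for x
    proof (cases "\<exists>m. x \<in> C n m")
      case True
      define L where "L = (LEAST m. x \<in> C n m)"
      have L: "x \<in> C n L" using True unfolding L_def by (rule LeastI_ex)
      have min: "x \<notin> C n j" if "j < L" for j using that not_less_Least unfolding L_def by blast
      have "decode q x n = L" using True by (auto simp: decode_def C_def L_def)
      moreover have "x \<notin> Z" using True by (auto simp: Z_def)
      moreover have "L = m \<longleftrightarrow> x \<in> C n m \<and> (\<forall>j<m. x \<notin> C n j)"
        using L min by (metis linorder_neqE_nat)
      ultimately show ?thesis by auto
    next
      case False
      then have "decode q x n = 0" by (simp add: decode_def C_def)
      then show ?thesis using False by (auto simp: Z_def)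
    qed
    then have "{x \<in> topspace cantorZ. decode q x n = m} =
        C n m \<inter> (topspace cantorZ \<inter> (\<Inter>j\<in>{..<m}. UNIV - C n j)) \<union> Z" by auto
    ultimately show ?thesis by (simp only:)
  qed
  then have "Delta0_measurable (Suc 5) cantorZ baire (decode q)"
    by (intro Delta0_measurable_baireI metrizable_cantorZ) auto
  then have "Delta0_measurable 6 (subtopology cantorZ X) baire (decode q \<circ> id)"
    by (intro Delta0_measurable_compose_continuous[of _ cantorZ] continuous_map_from_subtopology) auto
  then show ?thesis by simp
qed

section \<open>Continuity of the coding map and its inversion by \<open>decode\<close>\<close>

lemma continuous_map_encode: "continuous_map baire cantorZ (encode q u v)"
proof (rule continuous_map_baire_cantorZ)
  fix x :: "nat \<Rightarrow> nat" and i
  obtain n m where nm: "prod_decode (nat (i div q - 1)) = (n, m)" by fastforce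
  \<comment> \<open>Each coordinate of the code consults at most one value of
    \<open>y\<close>.\<close>
  have "encode q u v y i = encode q u v x i" if "\<forall>k<Suc n. y k = x k" for y
    using that by (simp add: encode_def nm)
  then show "\<exists>n. \<forall>y. (\<forall>k<n. y k = x k) \<longrightarrow> encode q u v y i = encode q u v x i" by blast
qed

text \<open>Left of 0 the code repeats \<open>u\<close>, and block 0 is \<open>v\<close>, so
  periodicity first fails at the first place \<open>p\<close> where \<open>u\<close> and
  \<open>v\<close> differ. Comparison at offset \<open>p\<close> then tells the two blocks apart
  everywhere.\<close>

lemma decode_encode:
  assumes q: "q > 0" and k: "0 \<le> k" "k < q" "u k \<noteq> v k"
  shows "decode q (encode q u v y) = y"
proof -
  define e where "e = encode q u v y"
  \<comment> \<open>The minimum is taken over the naturals, since the integers are not well ordered;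
    \<open>k\<close> bounds it below \<open>q\<close>.\<close>
  define p where "p = int (LEAST n. u (int n) \<noteq> v (int n))"
  have ex: "u (int (nat k)) \<noteq> v (int (nat k))" using k by simp
  have up: "u p \<noteq> v p" unfolding p_def by (rule LeastI[of "\<lambda>n. u (int n) \<noteq> v (int n)", OF ex])
  have "p \<le> k"
    using Least_le[of "\<lambda>n. u (int n) \<noteq> v (int n)", OF ex] k(1) unfolding p_def by linarith
  then have p: "0 \<le> p" "p < q" using k by (auto simp: p_def)
  have below: "u j = v j" if "0 \<le> j" "j < p" for j
  proof -
    have "nat j < (LEAST n. u (int n) \<noteq> v (int n))" using that unfolding p_def by linarith
    then show ?thesis using not_less_Least[of "nat j" "\<lambda>n. u (int n) \<noteq> v (int n)"] that by simp
  qed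
  have e_neg: "e j = u (j mod q)" if "j < 0" for j
  proof -
    have "j div q < 0" using that q by (simp add: pos_imp_zdiv_neg_iff)
    then show ?thesis by (simp add: e_def encode_def)
  qed
  have e_zero: "e j = v j" if "0 \<le> j" "j < q" for j
    using that by (simp add: e_def encode_def)
  have "first_break q e p"
    unfolding first_break_def
  proof (intro conjI allI impI)
    have "e (p - q) = u p" using e_neg[of "p - q"] p by (simp add: mod_pos_pos_trivial)
    then show "e p \<noteq> e (p - q)" using e_zero[OF p] up by simp
    fix j assume j: "j < p"
    show "e j = e (j - q)"
    proof (cases "j < 0")
      case True
      then show ?thesis using e_neg[of j] e_neg[of "j - q"] q by simp
    next
      case False
      then show ?thesis using e_zero[of j] e_neg[of "j - q"] below[of j] j p by simp
    qed
  qed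
  then have fb: "first_break q e i \<longleftrightarrow> i = p" for i using first_break_unique by blast
  have ep: "e (p - q) = u p" using e_neg[of "p - q"] p by simp
  have "coded q e (prod_encode (n, m)) \<longleftrightarrow> y n = m" for n m
  proof -
    let ?l = "prod_encode (n, m)"
    have "(p + (1 + int ?l) * q) div q = 1 + int ?l" "(p + (1 + int ?l) * q) mod q = p"
      using p by simp_all
    then have "e (p + (1 + int ?l) * q) = (if y n = m then v else u) p"
      by (simp add: e_def encode_def)
    then show ?thesis unfolding coded_def fb using ep up by auto
  qed
  then show ?thesis by (intro ext) (simp add: decode_def Least_equality flip: e_def)
qed

section \<open>Games\<close>

text \<open>The opponent's constant answer 0 is the punishing reply used below; \<open>h n\<close>
  is the position after \<open>n\<close> moves.\<close>

lemma follows_I_exists: "\<exists>x. follows_I \<sigma> x \<and> (\<forall>n. odd n \<longrightarrow> x n = 0)"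
proof -
  define h where "h = rec_nat [] (\<lambda>n l. l @ [if even n then \<sigma> l else (0::nat)])"
  have h: "h 0 = []" "\<And>n. h (Suc n) = h n @ [if even n then \<sigma> (h n) else 0]"
    by (simp_all add: h_def)
  define x where "x n = (if even n then \<sigma> (h n) else 0)" for n
  have "map x [0..<n] = h n" for n
    by (induction n) (simp_all add: h x_def)
  then have "follows_I \<sigma> x" by (simp add: follows_I_def x_def)
  then show ?thesis by (intro exI[of _ x]) (simp add: x_def)
qed

section \<open>Two preliminary moves\<close>

definition prepend :: "nat \<Rightarrow> nat \<Rightarrow> (nat \<Rightarrow> nat) \<Rightarrow> nat \<Rightarrow> nat" where
  "prepend a b y n = (case n of 0 \<Rightarrow> a | Suc 0 \<Rightarrow> b | Suc (Suc k) \<Rightarrow> y k)"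

lemma prepend_simps [simp]:
  "prepend a b y 0 = a" "prepend a b y (Suc 0) = b" "prepend a b y (Suc (Suc k)) = y k"
  by (simp_all add: prepend_def)

lemma map_prepend: "map (prepend a b y) [0..<Suc (Suc k)] = a # b # map y [0..<k]"
  by (induction k) auto

text \<open>A winning strategy of I must open with 0, since otherwise the reply 0 wins for II. After
  two moves the same player is on turn, so either winning strategy restricts to one for
  \<open>A\<close>.\<close>

lemma determined_prelude:
  assumes "determined A'"
    and play: "\<And>b y. prepend 0 b y \<in> A' \<longleftrightarrow> y \<in> A"
    and punish: "\<And>x. x 0 \<noteq> 0 \<Longrightarrow> x 1 = 0 \<Longrightarrow> x \<notin> A'"
  shows "determined A"
  using assms(1) unfolding determined_def[of A']
proof (elim disjE exE)
  fix \<sigma> assume \<sigma>: "\<forall>x. follows_I \<sigma> x \<longrightarrow> x \<in> A'"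
  obtain x where x: "follows_I \<sigma> x" "\<forall>n. odd n \<longrightarrow> x n = 0" using follows_I_exists by blast
  \<comment> \<open>II answers 0 here, so an opening other than 0 would be punished although
    \<open>x\<close> follows a winning strategy.\<close>
  have "x 1 = 0" using x(2) by simp
  then have "x 0 = 0" using x(1) \<sigma> punish by blast
  moreover have "x 0 = \<sigma> []" using x(1) unfolding follows_I_def by force
  ultimately have \<sigma>0: "\<sigma> [] = 0" by simp
  have "y \<in> A" if y: "follows_I (\<lambda>l. \<sigma> (0 # 0 # l)) y" for y
  proof -
    have "prepend 0 0 y n = \<sigma> (map (prepend 0 0 y) [0..<n])" if "even n" for n
    proof (cases n)
      case 0
      then show ?thesis using \<sigma>0 by simp
    next
      case (Suc n')
      then have "odd n'" using that by simp
      then obtain k where "n' = Suc k" "even k" by (cases n') auto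
      then have k: "n = Suc (Suc k)" "even k" using Suc by auto
      show ?thesis unfolding k(1) map_prepend using y k(2) by (simp add: follows_I_def)
    qed
    then have "prepend 0 0 y \<in> A'" using \<sigma> by (simp add: follows_I_def)
    then show ?thesis by (simp add: play)
  qed
  then show ?thesis unfolding determined_def by blast
next
  fix \<tau> assume \<tau>: "\<forall>x. follows_II \<tau> x \<longrightarrow> x \<notin> A'"
  \<comment> \<open>The reply of \<open>\<tau>\<close> to the opening 0, whose value is not known;
    \<open>play\<close> covers every \<open>b\<close>.\<close>
  define b where "b = \<tau> [0]"
  have "y \<notin> A" if y: "follows_II (\<lambda>l. \<tau> (0 # b # l)) y" for y
  proof -
    have "prepend 0 b y n = \<tau> (map (prepend 0 b y) [0..<n])" if "odd n" for n
    proof (cases "n = 1")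
      case True
      then show ?thesis by (simp add: b_def)
    next
      case False
      then have "n \<ge> 2" using that by (cases n) auto
      then obtain k where k: "n = Suc (Suc k)" by (metis add_2_eq_Suc le_Suc_ex)
      then have "odd k" using that by simp
      show ?thesis unfolding k map_prepend using y \<open>odd k\<close> by (simp add: follows_II_def)
    qed
    then have "prepend 0 b y \<notin> A'" using \<tau> by (simp add: follows_II_def)
    then show ?thesis by (simp add: play)
  qed
  then show ?thesis unfolding determined_def by blast
qed

text \<open>\<open>\<phi>\<close> carries the game of interest but need not be onto. Opening 0 leads
  to \<open>\<phi>\<close>; after any other opening the reply 0 yields \<open>z\<close> outside
  \<open>B\<close>, and any other reply hands over to \<open>\<psi>\<close>, which secures
  surjectivity.\<close>

lemma surjection_with_prelude:
  assumes \<phi>: "continuous_map baire T \<phi>" and \<psi>: "continuous_map baire T \<psi>" "range \<psi> = topspace T"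
    and z: "z \<in> topspace T" "z \<notin> B"
  obtains \<pi> where "continuous_map baire T \<pi>" "range \<pi> = topspace T"
    "determined (\<pi> -` B) \<Longrightarrow> determined (\<phi> -` B)"
proof -
  define tail :: "(nat \<Rightarrow> nat) \<Rightarrow> nat \<Rightarrow> nat" where "tail x n = x (Suc (Suc n))" for x n
  have tail_prepend: "tail (prepend a b y) = y" for a b y by (rule ext) (simp add: tail_def)
  define \<pi> where "\<pi> x = (if x 0 = 0 then \<phi> (tail x) else if x 1 = 0 then z else \<psi> (tail x))" for x
  have open_tail: "openin baire {x. f (tail x) \<in> U}" if f: "continuous_map baire T f" and "openin T U" for f U
  proof -
    have "openin baire {y. f y \<in> U}" using that by (auto simp: continuous_map_def)
    moreover have "continuous_map baire baire tail"
      unfolding baire_def tail_def[abs_def] continuous_map_componentwise_UNIV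
      using continuous_map_product_projection[of _ UNIV "\<lambda>_::nat. discrete_topology (UNIV::nat set)"] by simp
    ultimately show ?thesis by (auto simp: continuous_map_def)
  qed
  have open_fin: "openin baire {x. P (x 0) (x 1)}" for P
    unfolding openin_baire_iff by (intro ballI exI[of _ 2]) simp
  have "openin baire {x. \<pi> x \<in> U}" if U: "openin T U" for U
  proof -
    have "{x. \<pi> x \<in> U} = ({x. x 0 = 0} \<inter> {x. \<phi> (tail x) \<in> U}) \<union>
      ({x. x 0 \<noteq> 0 \<and> x 1 = 0 \<and> z \<in> U} \<union> ({x. x 0 \<noteq> 0 \<and> x 1 \<noteq> 0} \<inter> {x. \<psi> (tail x) \<in> U}))"
      by (auto simp: \<pi>_def)
    also have "openin baire \<dots>"
      using open_tail[OF \<phi> U] open_tail[OF \<psi>(1) U] open_fin[of "\<lambda>a b. a = 0"]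
        open_fin[of "\<lambda>a b. a \<noteq> 0 \<and> b = 0 \<and> z \<in> U"] open_fin[of "\<lambda>a b. a \<noteq> 0 \<and> b \<noteq> 0"]
      by (intro openin_Un openin_Int) auto
    finally show ?thesis .
  qed
  moreover have \<pi>T: "\<pi> x \<in> topspace T" for x
    using \<phi> \<psi> z by (auto simp: \<pi>_def continuous_map_def)
  ultimately have "continuous_map baire T \<pi>" by (auto simp: continuous_map_def)
  moreover have "range \<pi> = topspace T"
  proof (intro equalityI subsetI)
    fix t assume "t \<in> topspace T"
    then obtain y where "t = \<psi> y" using \<psi>(2) by blast
    then have "t = \<pi> (prepend 1 1 y)" by (simp add: \<pi>_def tail_prepend)
    then show "t \<in> range \<pi>" by blast
  qed (use \<pi>T in auto)
  moreover have "determined (\<phi> -` B)" if "determined (\<pi> -` B)"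
    using that by (rule determined_prelude) (auto simp: \<pi>_def tail_prepend z(2))
  ultimately show thesis by (rule that)
qed

section \<open>Transfer of determinacy from an invariant set to \<open>A\<close>\<close>

theorem theorem6p1:
  fixes X :: "(int \<Rightarrow> bool) set" and \<Gamma> :: point_family
  assumes "subshift_of_finite_type X"
    and "uncountable (X // shift_equiv X)"
    and "reasonable \<Gamma>"
    and "equiv_determinacy \<Gamma> (subtopology cantorZ X) (shift_equiv X)"
  shows "pointclass_determinacy \<Gamma>"
  unfolding pointclass_determinacy_def
proof
  fix A assume A: "A \<in> \<Gamma> baire"
  let ?T = "subtopology cantorZ X"
  have X: "closedin cantorZ X" by (rule closedin_subshift_of_finite_type[OF assms(1)])
  obtain N where N: "window_determined N X"
    using subshift_of_finite_type_imp_window_determined[OF assms(1)] .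
  have "uncountable X"
  proof
    assume "countable X"
    then have "countable (X // shift_equiv X)" by (simp add: quotient_def)
    then show False using assms(2) by contradiction
  qed
  then have "X \<noteq> {}" "\<not> unique_returns N X"
    using unique_returns_imp_countable[OF N] by auto
  \<comment> \<open>The two return paths share the window that begins \<open>u\<close>, but differ
    at some \<open>k\<close> within their first \<open>q\<close> letters.\<close>
  then obtain q u v k where quv: "q > 0" "u \<in> X" "v \<in> X"
    "\<And>j. 0 \<le> j \<Longrightarrow> j < N \<Longrightarrow> v j = u j \<and> u (q + j) = u j \<and> v (q + j) = u j"
    and k: "0 \<le> k" "k < q" "u k \<noteq> v k"
    unfolding unique_returns_def by blast
  have "encode q u v y \<in> X" for y
  proof -
    \<comment> \<open>The block selector in \<open>encode\<close>; as a function of the block index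
      it gives the code the form required by \<open>concat_blocks_in\<close>.\<close>
    define c where "c d \<longleftrightarrow> d = 0 \<or> d > 0 \<and> (case prod_decode (nat (d - 1)) of (n, m) \<Rightarrow> y n = m)"
      for d :: int
    have "(\<lambda>k. (if c (k div q) then v else u) (k mod q)) \<in> X"
      by (rule concat_blocks_in[OF N quv(1), of "\<lambda>b. if b then v else u" u]) (use quv in auto)
    then show ?thesis by (simp add: encode_def[abs_def] c_def)
  qed
  then have \<phi>: "continuous_map baire ?T (encode q u v)"
    using continuous_map_encode by (simp add: continuous_map_in_subtopology)
  define B where "B = {x \<in> topspace ?T. decode q x \<in> A}"
  have \<phi>B: "encode q u v -` B = A"
    using \<open>\<And>y. encode q u v y \<in> X\<close> decode_encode[of q k u v, OF quv(1) k] by (auto simp: B_def)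
  have "invariant_under (shift_equiv X) B"
    unfolding invariant_under_def
  proof clarify
    fix x y assume "(x, y) \<in> shift_equiv X"
    then obtain m where "x \<in> X" "y \<in> X" "\<And>k. y k = x (k + m)" unfolding shift_equiv_def by blast
    then show "x \<in> B \<longleftrightarrow> y \<in> B" using decode_shift[of y x m q] by (simp add: B_def)
  qed
  moreover have "in_pointclass \<Gamma> ?T B"
    unfolding B_def
    by (rule in_pointclass_Delta0_preimage[OF assms(3) polish_closed_cantorZ[OF X] decode_measurable A])
  moreover have "B \<subseteq> topspace ?T" by (auto simp: B_def)
  ultimately have det: "determined (\<pi> -` B)" if "continuous_map baire ?T \<pi>" "range \<pi> = topspace ?T" for \<pi>
    using assms(4) that unfolding equiv_determinacy_def by blast
  show "determined A"
  \<comment> \<open>The punishing point \<open>z\<close> must lie outside \<open>B\<close>. It is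
    the code of some \<open>y\<close> outside \<open>A\<close>, which exists unless I wins
    trivially.\<close>
  proof (cases "A = UNIV")
    case True
    then show ?thesis by (simp add: determined_def)
  next
    case False
    then obtain y where "y \<notin> A" by blast
    then have z: "encode q u v y \<in> topspace ?T" "encode q u v y \<notin> B"
      using \<open>\<And>y. encode q u v y \<in> X\<close> \<phi>B by auto
    obtain \<psi> where \<psi>: "continuous_map baire ?T \<psi>" "range \<psi> = topspace ?T"
      using closed_cantorZ_baire_surjection[OF X \<open>X \<noteq> {}\<close>] by auto
    show ?thesis
      by (rule surjection_with_prelude[OF \<phi> \<psi> z]) (use det \<phi>B in simp)
  qed
qed

end
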